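(* We have $$S_1\!\left(e^{-6\pi}\right)=\frac{1}{\sqrt{2}}\left(\sqrt{2}-1\right)^{1/2}\left(\sqrt{3}-\sqrt{2}\right)^{1/2}\left(\sqrt{\frac{\sqrt{3}+3}{2}}-\sqrt{\frac{\sqrt{3}+1}{2}}\right),$$ $$S_1\!\left(e^{-2\pi/3}\right)=\frac{1}{\sqrt{2}}\left(\sqrt{2}-1\right)^{1/2}\left(\sqrt{3}-\sqrt{2}\right)^{1/2}\left(\sqrt{\frac{\sqrt{3}+3}{2}}+\sqrt{\frac{\sqrt{3}+1}{2}}\right),$$ $$S_1\!\left(e^{-6\sqrt{2}\pi}\right)=\frac{1}{\sqrt{2}}\left(\sqrt{\frac{\sqrt{2}+2}{2}}-\sqrt{\frac{\sqrt{2}}{2}}\right)^{2}\left(\sqrt{\frac{3\sqrt{2}+6}{2}}-\sqrt{\frac{3\sqrt{2}+4}{2}}\right),$$ $$S_1\!\left(e^{-2\sqrt{2}\pi/3}\right)=\frac{1}{\sqrt{2}}\left(\sqrt{\frac{\sqrt{2}+2}{2}}-\sqrt{\frac{\sqrt{2}}{2}}\right)^{2}\left(\sqrt{\frac{3\sqrt{2}+6}{2}}+\sqrt{\frac{3\sqrt{2}+4}{2}}\right).$$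
   Context: For $|x|<1$ let $(a;x)_\infty=\prod_{k\ge0}(1-ax^k)$. For $0<q<1$, the Ramanujan–Selberg continued fraction is $S_1(q)=\dfrac{q^{1/8}(-q^2;q^2)_\infty}{(-q;q^2)_\infty}$ (equal to $\frac{q^{1/8}}{1+}\frac{q}{1+}\frac{q+q^2}{1+}\frac{q^3}{1+}\frac{q^2+q^4}{1+}\cdots$), with $q^{1/8}$ the positive real root. *)

theory Defs
  imports "HOL-Analysis.Analysis"
begin

text \<open>
  The infinite $q$-Pochhammer symbol $(a; x)_\infty$; the product converges for $|x| < 1$,
  see the lemma below.
\<close>
definition qpoch_inf :: "real \<Rightarrow> real \<Rightarrow> real" where
  "qpoch_inf a x = (\<Prod>k. 1 - a * x ^ k)"

lemma has_prod_qpoch_inf: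
  assumes "\<bar>x\<bar> < 1"
  shows "(\<lambda>k. 1 - a * x ^ k) has_prod qpoch_inf a x"
proof -
  have "summable (\<lambda>k. \<bar>a\<bar> * \<bar>x\<bar> ^ k)"
    using assms by (intro summable_mult summable_geometric) simp
  hence "summable (\<lambda>k. norm (1 - a * x ^ k - 1))"
    by (simp add: abs_mult power_abs)
  hence "convergent_prod (\<lambda>k. 1 - a * x ^ k)"
    by (intro abs_convergent_prod_imp_convergent_prod summable_imp_abs_convergent_prod)
  thus ?thesis
    unfolding qpoch_inf_def by (rule convergent_prod_has_prod)
qed

text \<open>
  The Ramanujan--Selberg continued fraction, given by its product form.  It is meaningful
  for $0 < q < 1$; there \<^term>\<open>q powr (1/8)\<close> is the positive real eighth root of $q$.
\<close>
definition ramanujan_selberg_S1 :: "real \<Rightarrow> real" where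
  "ramanujan_selberg_S1 q =
     q powr (1/8) * qpoch_inf (- (q\<^sup>2)) (q\<^sup>2) / qpoch_inf (- q) (q\<^sup>2)"

end

theory Submission
  imports Defs "HOL-Probability.Distributions"
begin


text \<open>
  Put $q = e^{-s}$, $\theta_2 = \sum_k q^{(k+1/2)^2}$, $\theta_3 = \sum_k q^{k^2}$ and
  $\theta_4 = \sum_k (-1)^k q^{k^2}$.  By the Jacobi triple product, $u(s) = \theta_2 / \theta_3$
  equals $2 S_1(q)^2$.  Rearranging double series gives the duplication formulas, the identity
  $\theta_3^4 = \theta_2^4 + \theta_4^4$ and the modular equation of degree three,
  $(1 - u(s) u(3s))^4 = (1 - u(s)^4)(1 - u(3s)^4)$.

  The values $u(2\pi)$ and $u(2\sqrt2\pi)$ come from the arithmetic-geometric mean $M$ instead of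
  the modular transformation of the theta functions.  The duplication formulas say that the AGM
  iteration starting from $(\theta_3^2, \theta_4^2)$ runs through the values at $2^n s$, and the one
  starting from $(\theta_3^2, \theta_2^2)$ through $2^{-n}$ times the values at $2^{-n} s$.  Hence
  $M(\theta_3^2, \theta_4^2) = 1$, and comparison with the Gaussian integral yields
  $M(\theta_3^2, \theta_2^2) = \pi / s$.  Strict monotonicity of $M$ then determines $u(\pi)$ and
  $u(\sqrt2\pi)$, and duplication determines $u(2\pi)$ and $u(2\sqrt2\pi)$.

  For $w = u(3s)$ both $u(s)$ and $u(9s)$ are positive roots of the same quartic, which has exactly
  two of them; the inequality $u(9s) < u(s)$ tells which is which.
\<close>

subsection \<open>Theta series\<close>

text \<open>With q = e^(-s), \<open>theta 0 s\<close> is theta_3 and \<open>theta (1/2) s\<close> is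
  theta_2; a general shift \<open>c\<close> plays the role of the free variable in the triple
  product. The unordered sum over the integers permits reindexing, and its default value 0 makes
  \<open>theta_nonneg\<close> valid for every \<open>s\<close>.\<close>

definition theta :: "real \<Rightarrow> real \<Rightarrow> real" where
  "theta c s = (\<Sum>\<^sub>\<infinity>k::int. exp (- s * (of_int k + c)\<^sup>2))"

lemma summable_on_power_nat_abs:
  fixes r :: real
  assumes "0 \<le> r" "r < 1"
  shows "(\<lambda>k::int. r ^ nat \<bar>k\<bar>) summable_on UNIV"
proof -
  have s: "(\<lambda>n. r ^ n) summable_on UNIV"
    using assms by (intro summable_nonneg_imp_summable_on summable_geometric) auto
  have "(\<lambda>k::int. r ^ nat \<bar>k\<bar>) summable_on range int"
    by (subst summable_on_reindex) (use s in \<open>auto simp: o_def inj_on_def\<close>)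
  moreover have "(\<lambda>k::int. r ^ nat \<bar>k\<bar>) summable_on range (\<lambda>n. - int n)"
    by (subst summable_on_reindex) (use s in \<open>auto simp: o_def inj_on_def\<close>)
  moreover have "range int \<union> range (\<lambda>n. - int n) = UNIV"
  proof -
    have "k \<in> range int \<union> range (\<lambda>n. - int n)" for k
      by (cases k rule: int_cases2) auto
    thus ?thesis by auto
  qed
  ultimately show ?thesis
    by (metis summable_on_union)
qed

text \<open>From (|x| - 1)^2 >= 0 the square is at least 2|x| - 1, so the Gaussian is dominated by a
  two-sided geometric series.\<close>

lemma exp_gauss_le:
  fixes k :: int and s c :: real
  assumes "s > 0"
  shows "exp (- s * (of_int k + c)\<^sup>2) \<le> exp (s * (2 * \<bar>c\<bar> + 1)) * exp (- 2 * s) ^ nat \<bar>k\<bar>"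
proof -
  have "0 \<le> (\<bar>of_int k + c\<bar> - 1)\<^sup>2" by simp
  hence "(of_int k + c)\<^sup>2 \<ge> 2 * \<bar>of_int k + c\<bar> - 1"
    by (simp add: power2_eq_square algebra_simps)
  moreover have "2 * \<bar>of_int k + c\<bar> - 1 \<ge> 2 * \<bar>of_int k\<bar> - 2 * \<bar>c\<bar> - 1"
    using abs_triangle_ineq2[of "of_int k" "- c"] by simp
  ultimately have "(of_int k + c)\<^sup>2 \<ge> 2 * \<bar>of_int k\<bar> - 2 * \<bar>c\<bar> - 1" by (rule order_trans[rotated])
  hence "s * (of_int k + c)\<^sup>2 \<ge> s * (2 * \<bar>of_int k\<bar> - 2 * \<bar>c\<bar> - 1)"
    using assms by simp
  hence "exp (- s * (of_int k + c)\<^sup>2) \<le> exp (s * (2 * \<bar>c\<bar> + 1) + of_nat (nat \<bar>k\<bar>) * (- 2 * s))"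
    by (simp add: algebra_simps)
  also have "\<dots> = exp (s * (2 * \<bar>c\<bar> + 1)) * exp (- 2 * s) ^ nat \<bar>k\<bar>"
    by (simp only: exp_add exp_of_nat_mult)
  finally show ?thesis .
qed

lemma summable_on_gauss_bound:
  fixes s c :: real
  assumes "s > 0"
  shows "(\<lambda>k::int. exp (s * (2 * \<bar>c\<bar> + 1)) * exp (- 2 * s) ^ nat \<bar>k\<bar>) summable_on UNIV"
  using assms by (intro summable_on_cmult_right summable_on_power_nat_abs) auto

lemma summable_on_gauss:
  fixes s c :: real
  assumes "s > 0"
  shows "(\<lambda>k::int. exp (- s * (of_int k + c)\<^sup>2)) summable_on UNIV"
  by (rule summable_on_comparison_test[OF summable_on_gauss_bound[OF assms, of c]])
     (use exp_gauss_le[OF assms] in auto)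

lemma has_sum_theta:
  assumes "s > 0"
  shows "((\<lambda>k::int. exp (- s * (of_int k + c)\<^sup>2)) has_sum theta c s) UNIV"
  using summable_on_gauss[OF assms, of c] unfolding theta_def by simp

lemma has_sum_times:
  fixes f :: "'a \<Rightarrow> real" and g :: "'b \<Rightarrow> real"
  assumes "(f has_sum a) UNIV" "(g has_sum b) UNIV" "\<And>x. f x \<ge> 0" "\<And>y. g y \<ge> 0"
  shows "((\<lambda>(x, y). f x * g y) has_sum a * b) UNIV"
proof -
  have i: "((\<lambda>y. case (x, y) of (x, y) \<Rightarrow> f x * g y) has_sum f x * b) UNIV" for x
    using has_sum_cmult_right[OF assms(2), of "f x"] by simp
  have o: "((\<lambda>x. f x * b) has_sum a * b) UNIV"
    by (rule has_sum_cmult_left[OF assms(1)])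
  have "(\<lambda>(x, y). f x * g y) summable_on UNIV \<times> UNIV"
    by (rule summable_on_SigmaI[where g = "\<lambda>x. f x * b"])
       (use i o assms(3,4) in \<open>auto simp: summable_on_def\<close>)
  from has_sum_SigmaI[OF i o this] show ?thesis by simp
qed

lemma has_sum_theta_prod:
  assumes "s > 0" "t > 0"
  shows "((\<lambda>(j::int, k::int). exp (- (s * (of_int j + c)\<^sup>2 + t * (of_int k + d)\<^sup>2)))
            has_sum theta c s * theta d t) UNIV"
proof -
  have "(\<lambda>(j::int, k::int). exp (- (s * (of_int j + c)\<^sup>2 + t * (of_int k + d)\<^sup>2))) =
        (\<lambda>(j, k). exp (- s * (of_int j + c)\<^sup>2) * exp (- t * (of_int k + d)\<^sup>2))"
    by (auto simp: fun_eq_iff exp_add[symmetric])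
  thus ?thesis
    using has_sum_times[OF has_sum_theta[OF assms(1), of c] has_sum_theta[OF assms(2), of d]] by simp
qed

text \<open>The device behind all rearrangements below: an index set is cut into two classes,
  usually by parity, and each class is parametrized injectively.\<close>

lemma has_sum_two_parts:
  fixes f :: "'b \<Rightarrow> real" and g h :: "'a \<Rightarrow> 'b"
  assumes "((\<lambda>x. f (g x)) has_sum a) UNIV" "((\<lambda>x. f (h x)) has_sum b) UNIV"
    and "inj g" "inj h" "\<And>y. y \<in> range g \<longleftrightarrow> y \<notin> range h"
  shows "(f has_sum a + b) UNIV"
proof -
  have "(f has_sum a) (range g)" "(f has_sum b) (range h)"
    using assms by (simp_all add: has_sum_reindex o_def)
  moreover have "range g \<inter> range h = {}" "range g \<union> range h = UNIV" using assms(5) by auto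
  ultimately show ?thesis
    using has_sum_Un_disjoint by metis
qed

section \<open>Identities from parity classes of indices and index pairs\<close>

lemma theta_split:
  assumes "s > 0"
  shows "theta 0 s = theta 0 (4 * s) + theta (1/2) (4 * s)"
proof -
  have "((\<lambda>k::int. exp (- s * (of_int k + 0)\<^sup>2)) has_sum theta 0 (4 * s) + theta (1/2) (4 * s)) UNIV"
  proof (rule has_sum_two_parts[where g = "\<lambda>k. 2 * k" and h = "\<lambda>k. 2 * k + 1"])
    show "((\<lambda>k::int. exp (- s * (of_int (2 * k) + 0)\<^sup>2)) has_sum theta 0 (4 * s)) UNIV"
      using has_sum_theta[of "4 * s" 0] assms by (simp add: power2_eq_square algebra_simps)
    have "(\<lambda>k::int. exp (- s * (of_int (2 * k + 1) + 0)\<^sup>2)) =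
          (\<lambda>k. exp (- (4 * s) * (of_int k + 1/2)\<^sup>2))"
      by (simp add: fun_eq_iff power2_eq_square field_simps)
    thus "((\<lambda>k::int. exp (- s * (of_int (2 * k + 1) + 0)\<^sup>2)) has_sum theta (1/2) (4 * s)) UNIV"
      using has_sum_theta[of "4 * s" "1/2"] assms by simp
    show "y \<in> range (\<lambda>k. 2 * k) \<longleftrightarrow> y \<notin> range (\<lambda>k. 2 * k + 1)" for y :: int
      unfolding image_iff by simp presburger
  qed (auto simp: inj_on_def)
  with has_sum_theta[OF assms, of 0] show ?thesis
    using has_sum_unique by blast
qed

lemma even_diff_pair_iff:
  fixes y :: "int \<times> int"
  shows "y \<in> range (\<lambda>(m, n). (m + n, m - n)) \<longleftrightarrow> even (fst y - snd y)"
proof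
  assume "even (fst y - snd y)"
  then obtain d where "fst y - snd y = 2 * d" by (rule evenE)
  hence "y = (case (snd y + d, d) of (m, n) \<Rightarrow> (m + n, m - n))" by (simp add: prod_eq_iff)
  thus "y \<in> range (\<lambda>(m, n). (m + n, m - n))" by blast
qed auto

lemma odd_diff_pair_iff:
  fixes y :: "int \<times> int"
  shows "y \<in> range (\<lambda>(m, n). (m + n + 1, m - n)) \<longleftrightarrow> odd (fst y - snd y)"
    and "y \<in> range (\<lambda>(m, n). (m + n, n - m - 1)) \<longleftrightarrow> odd (fst y - snd y)"
proof -
  have *: "y \<in> range (\<lambda>(m, n). (m + n + 1, m - n)) \<and> y \<in> range (\<lambda>(m, n). (m + n, n - m - 1))"
    if "odd (fst y - snd y)"
  proof -
    from that obtain d where "fst y - snd y = 2 * d + 1" by (rule oddE)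
    hence "y = (case (snd y + d, d) of (m, n) \<Rightarrow> (m + n + 1, m - n))"
      "y = (case (d, snd y + d + 1) of (m, n) \<Rightarrow> (m + n, n - m - 1))"
      by (simp_all add: prod_eq_iff)
    thus ?thesis by blast
  qed
  show "y \<in> range (\<lambda>(m, n). (m + n + 1, m - n)) \<longleftrightarrow> odd (fst y - snd y)"
    and "y \<in> range (\<lambda>(m, n). (m + n, n - m - 1)) \<longleftrightarrow> odd (fst y - snd y)"
    using * by auto
qed

text \<open>Pairs of equal parity are (m + n, m - n) and contribute 2m^2 + 2n^2 to the exponent.
  Pairs of opposite parity are (m + n + 1, m - n), which is the same map at m + 1/2 and n +
  1/2.\<close>

lemma theta3_square:
  assumes "s > 0"
  shows "(theta 0 s)\<^sup>2 = (theta 0 (2 * s))\<^sup>2 + (theta (1/2) (2 * s))\<^sup>2"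
proof -
  define f :: "int \<times> int \<Rightarrow> real" where
    "f = (\<lambda>(j, k). exp (- (s * (of_int j + 0)\<^sup>2 + s * (of_int k + 0)\<^sup>2)))"
  have "(f has_sum (theta 0 (2 * s) * theta 0 (2 * s) + theta (1/2) (2 * s) * theta (1/2) (2 * s))) UNIV"
  proof (rule has_sum_two_parts[where g = "\<lambda>(m, n). (m + n, m - n)" and h = "\<lambda>(m, n). (m + n + 1, m - n)"])
    have "(\<lambda>x. f (case x of (m, n) \<Rightarrow> (m + n, m - n))) =
          (\<lambda>(j, k). exp (- (2 * s * (of_int j + 0)\<^sup>2 + 2 * s * (of_int k + 0)\<^sup>2)))"
      by (auto simp: f_def fun_eq_iff power2_eq_square algebra_simps)
    thus "((\<lambda>x. f (case x of (m, n) \<Rightarrow> (m + n, m - n))) has_sum theta 0 (2 * s) * theta 0 (2 * s)) UNIV"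
      using has_sum_theta_prod[of "2 * s" "2 * s" 0 0] assms by simp
    have "(\<lambda>x. f (case x of (m, n) \<Rightarrow> (m + n + 1, m - n))) =
          (\<lambda>(j, k). exp (- (2 * s * (of_int j + 1/2)\<^sup>2 + 2 * s * (of_int k + 1/2)\<^sup>2)))"
      by (auto simp: f_def fun_eq_iff power2_eq_square field_simps)
    thus "((\<lambda>x. f (case x of (m, n) \<Rightarrow> (m + n + 1, m - n))) has_sum theta (1/2) (2 * s) * theta (1/2) (2 * s)) UNIV"
      using has_sum_theta_prod[of "2 * s" "2 * s" "1/2" "1/2"] assms by simp
    show "y \<in> range (\<lambda>(m, n). (m + n, m - n)) \<longleftrightarrow> y \<notin> range (\<lambda>(m, n). (m + n + 1, m - n))" for y :: "int \<times> int"
      by (simp only: even_diff_pair_iff odd_diff_pair_iff not_not)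
  qed (auto simp: inj_on_def)
  moreover have "(f has_sum theta 0 s * theta 0 s) UNIV"
    unfolding f_def using assms by (intro has_sum_theta_prod)
  ultimately show ?thesis
    by (simp add: power2_eq_square has_sum_unique)
qed

text \<open>Both parity classes contribute the same sum, with exponent 2(m + 1/2)^2 + 2n^2: the
  reflection k -> -1 - k changes the sign of k + 1/2 and swaps the classes.\<close>

lemma theta2_square:
  assumes "s > 0"
  shows "(theta (1/2) s)\<^sup>2 = 2 * theta (1/2) (2 * s) * theta 0 (2 * s)"
proof -
  define f :: "int \<times> int \<Rightarrow> real" where
    "f = (\<lambda>(j, k). exp (- (s * (of_int j + 1/2)\<^sup>2 + s * (of_int k + 1/2)\<^sup>2)))"
  have *: "((\<lambda>(j::int, k::int). exp (- (2 * s * (of_int j + 1/2)\<^sup>2 + 2 * s * (of_int k + 0)\<^sup>2)))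
         has_sum theta (1/2) (2 * s) * theta 0 (2 * s)) UNIV"
    using assms by (intro has_sum_theta_prod) auto
  have "(f has_sum (theta (1/2) (2 * s) * theta 0 (2 * s) + theta (1/2) (2 * s) * theta 0 (2 * s))) UNIV"
  proof (rule has_sum_two_parts[where g = "\<lambda>(m, n). (m + n, m - n)" and h = "\<lambda>(m, n). (m + n, n - m - 1)"])
    have "(\<lambda>x. f (case x of (m, n) \<Rightarrow> (m + n, m - n))) =
          (\<lambda>(j, k). exp (- (2 * s * (of_int j + 1/2)\<^sup>2 + 2 * s * (of_int k + 0)\<^sup>2)))"
      by (auto simp: f_def fun_eq_iff power2_eq_square field_simps)
    with * show "((\<lambda>x. f (case x of (m, n) \<Rightarrow> (m + n, m - n))) has_sum theta (1/2) (2 * s) * theta 0 (2 * s)) UNIV"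
      by simp
    have "(\<lambda>x. f (case x of (m, n) \<Rightarrow> (m + n, n - m - 1))) =
          (\<lambda>(j, k). exp (- (2 * s * (of_int j + 1/2)\<^sup>2 + 2 * s * (of_int k + 0)\<^sup>2)))"
      by (auto simp: f_def fun_eq_iff power2_eq_square field_simps)
    with * show "((\<lambda>x. f (case x of (m, n) \<Rightarrow> (m + n, n - m - 1))) has_sum theta (1/2) (2 * s) * theta 0 (2 * s)) UNIV"
      by simp
    show "y \<in> range (\<lambda>(m, n). (m + n, m - n)) \<longleftrightarrow> y \<notin> range (\<lambda>(m, n). (m + n, n - m - 1))" for y :: "int \<times> int"
      by (simp only: even_diff_pair_iff odd_diff_pair_iff not_not)
  qed (auto simp: inj_on_def)
  moreover have "(f has_sum theta (1/2) s * theta (1/2) s) UNIV"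
    unfolding f_def using assms by (intro has_sum_theta_prod)
  ultimately have "theta (1/2) (2 * s) * theta 0 (2 * s) + theta (1/2) (2 * s) * theta 0 (2 * s) =
      theta (1/2) s * theta (1/2) s"
    by (rule has_sum_unique)
  thus ?thesis by (simp add: power2_eq_square mult.commute)
qed

text \<open>
  With $X = (x + 3y)/2$ and $Y = (x - y)/2$ one has $x^2 + 3y^2 = X^2 + 3Y^2$.  The half-odd pairs
  $(x, y)$ with $x - y$ even correspond to the integer pairs $(X, Y)$ of opposite parity; the
  other ones are reduced to these by $y \mapsto -y$.
\<close>
lemma theta2_cubic:
  assumes "s > 0"
  shows "theta (1/2) s * theta (1/2) (3 * s) =
           2 * (theta 0 (4 * s) * theta (1/2) (12 * s) + theta (1/2) (4 * s) * theta 0 (12 * s))"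
proof -
  define f :: "int \<times> int \<Rightarrow> real" where
    "f = (\<lambda>(j, k). exp (- (s * (of_int j + 1/2)\<^sup>2 + 3 * s * (of_int k + 1/2)\<^sup>2)))"
  define S where "S = theta 0 (4 * s) * theta (1/2) (12 * s) + theta (1/2) (4 * s) * theta 0 (12 * s)"
  define F :: "bool \<times> int \<times> int \<Rightarrow> real" where
    "F = (\<lambda>(b, m, n). if b then exp (- (4 * s * (of_int m + 0)\<^sup>2 + 12 * s * (of_int n + 1/2)\<^sup>2))
                       else exp (- (4 * s * (of_int m + 1/2)\<^sup>2 + 12 * s * (of_int n + 0)\<^sup>2)))"
  have *: "(F has_sum S) UNIV"
    unfolding S_def
  proof (rule has_sum_two_parts[where g = "\<lambda>x. (True, x)" and h = "\<lambda>x. (False, x)"])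
    show "((\<lambda>x. F (True, x)) has_sum theta 0 (4 * s) * theta (1/2) (12 * s)) UNIV"
      using has_sum_theta_prod[of "4 * s" "12 * s" 0 "1/2"] assms by (simp add: F_def case_prod_unfold)
    show "((\<lambda>x. F (False, x)) has_sum theta (1/2) (4 * s) * theta 0 (12 * s)) UNIV"
      using has_sum_theta_prod[of "4 * s" "12 * s" "1/2" 0] assms by (simp add: F_def case_prod_unfold)
  qed (auto simp: inj_on_def)
  \<comment> \<open>The flag tells which of X, Y is even: X = 2m and Y = 2n + 1 if true, X = 2m + 1
    and Y = 2n if false. The inverse substitution is x = (X + 3Y)/2, y = (X - Y)/2, and the index
    pair is (x - 1/2, y - 1/2). The map \<open>h\<close> is \<open>g\<close> followed by k -> -1 -
    k, that is y -> -y.\<close>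
  define g h :: "bool \<times> int \<times> int \<Rightarrow> int \<times> int" where
    "g = (\<lambda>(b, m, n). if b then (m + 3 * n + 1, m - n - 1) else (m + 3 * n, m - n))" and
    "h = (\<lambda>(b, m, n). if b then (m + 3 * n + 1, n - m) else (m + 3 * n, n - m - 1))"
  have g: "y \<in> range g \<longleftrightarrow> even (fst y - snd y)" for y
  proof
    assume "even (fst y - snd y)"
    then obtain d where d: "fst y - snd y = 2 * d" by (rule evenE)
    show "y \<in> range g"
    proof (cases "even d")
      case True
      then obtain n where "d = 2 * n" by blast
      hence "y = g (False, snd y + n, n)" using d by (simp add: g_def prod_eq_iff)
      thus ?thesis by blast
    next
      case False
      then obtain n where "d = 2 * n + 1" by (rule oddE)
      hence "y = g (True, snd y + n + 1, n)" using d by (simp add: g_def prod_eq_iff)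
      thus ?thesis by blast
    qed
  qed (auto simp: g_def split: if_splits)
  have h: "y \<in> range h \<longleftrightarrow> odd (fst y - snd y)" for y
  proof
    assume "odd (fst y - snd y)"
    hence "even (fst y + snd y + 1)" by simp
    then obtain d where d: "fst y + snd y + 1 = 2 * d" by (rule evenE)
    show "y \<in> range h"
    proof (cases "even d")
      case True
      then obtain n where "d = 2 * n" by blast
      hence "y = h (False, n - snd y - 1, n)" using d by (simp add: h_def prod_eq_iff)
      thus ?thesis by blast
    next
      case False
      then obtain n where "d = 2 * n + 1" by (rule oddE)
      hence "y = h (True, n - snd y, n)" using d by (simp add: h_def prod_eq_iff)
      thus ?thesis by blast
    qed
  qed (auto simp: h_def split: if_splits)
  have "(f has_sum S + S) UNIV"
  proof (rule has_sum_two_parts[where g = g and h = h])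
    have "(\<lambda>x. f (g x)) = F" "(\<lambda>x. f (h x)) = F"
      by (auto simp: f_def F_def g_def h_def fun_eq_iff power2_eq_square field_simps)
    with * show "((\<lambda>x. f (g x)) has_sum S) UNIV" "((\<lambda>x. f (h x)) has_sum S) UNIV" by simp_all
    show "inj g"
      unfolding g_def inj_on_def by (auto split: if_splits) presburger+
    show "inj h"
      unfolding h_def inj_on_def by (auto split: if_splits) presburger+
    show "y \<in> range g \<longleftrightarrow> y \<notin> range h" for y using g h by simp
  qed
  moreover have "(f has_sum theta (1/2) s * theta (1/2) (3 * s)) UNIV"
    unfolding f_def using assms by (intro has_sum_theta_prod) auto
  ultimately have "S + S = theta (1/2) s * theta (1/2) (3 * s)" by (rule has_sum_unique)
  thus ?thesis by (simp add: S_def mult.commute)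
qed


subsection \<open>The Jacobi triple product\<close>

definition qfact :: "real \<Rightarrow> nat \<Rightarrow> real" where
  "qfact p n = (\<Prod>i<n. 1 - p ^ Suc i)"

text \<open>Continuing the reciprocal by 0 to negative integers makes the recurrence
  \<open>inv_qfact_rec\<close> valid everywhere: at m = -1 the factor 1 - p^0 vanishes.\<close>

definition inv_qfact :: "real \<Rightarrow> int \<Rightarrow> real" where
  "inv_qfact p m = (if m < 0 then 0 else inverse (qfact p (nat m)))"

text \<open>The Gaussian binomial coefficient of 2n over n + k to base p; it vanishes for |k| > n,
  so sums over it may run over all integers.\<close>

definition central_qbinom :: "real \<Rightarrow> nat \<Rightarrow> int \<Rightarrow> real" where
  "central_qbinom p n k = qfact p (2 * n) * inv_qfact p (int n + k) * inv_qfact p (int n - k)"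

lemma qfact_pos:
  assumes "0 < p" "p < 1"
  shows "qfact p n > 0"
  unfolding qfact_def using assms
  by (intro prod_pos) (auto simp del: power_Suc simp: power_less_one_iff)

lemma qfact_Suc: "qfact p (Suc n) = qfact p n * (1 - p ^ Suc n)"
  by (simp add: qfact_def)

lemma inv_qfact_rec:
  assumes "0 < p" "p < 1"
  shows "inv_qfact p m = (1 - p powi (m + 1)) * inv_qfact p (m + 1)"
proof (cases "m < 0")
  case True
  then consider "m = -1" | "m + 1 < 0" by linarith
  thus ?thesis by cases (auto simp: inv_qfact_def)
next
  case False
  then obtain n where n: "m = int n" using nonneg_int_cases by (metis not_le)
  have "1 - p ^ Suc n > 0"
    using assms by (simp del: power_Suc add: power_less_one_iff)
  moreover have "p powi (m + 1) = p ^ Suc n"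
    unfolding n by (metis of_nat_Suc add.commute power_int_of_nat)
  moreover have "nat (m + 1) = Suc n" using n by simp
  ultimately show ?thesis
    using n qfact_pos[OF assms, of n] by (simp add: inv_qfact_def qfact_Suc field_simps del: power_Suc)
qed

text \<open>Two steps of the q-Pascal rule at once. The recurrence for \<open>inv_qfact\<close>
  writes every term as a multiple of the common \<open>R\<close>, which leaves a polynomial identity
  in p, x, y without boundary cases in k.\<close>

lemma central_qbinom_Suc:
  assumes "0 < p" "p < 1"
  shows "central_qbinom p (Suc n) k =
           (1 + p ^ (2 * n + 1)) * central_qbinom p n k +
           p powi (int n + 1 - k) * central_qbinom p n (k - 1) +
           p powi (int n + 1 + k) * central_qbinom p n (k + 1)"
proof -
  define x y R where "x = p powi (int n + k)" and "y = p powi (int n - k)"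
    and "R = inv_qfact p (int n + k + 1) * inv_qfact p (int n - k + 1)"
  have p: "p \<noteq> 0" using assms by simp
  have pS: "p powi (m + 1) = p * p powi m" for m
    using p by (simp add: power_int_add mult.commute)
  have xy: "p ^ (2 * n) = x * y"
  proof -
    have "x * y = p powi (int n + k + (int n - k))"
      unfolding x_def y_def by (rule power_int_add[symmetric]) (use p in simp)
    also have "int n + k + (int n - k) = int (2 * n)" by simp
    finally show ?thesis by (simp only: power_int_of_nat)
  qed
  have r: "inv_qfact p (int n + k) = (1 - p * x) * inv_qfact p (int n + k + 1)"
    "inv_qfact p (int n - k) = (1 - p * y) * inv_qfact p (int n - k + 1)"
    unfolding x_def y_def pS[symmetric] by (rule inv_qfact_rec[OF assms])+
  have r': "inv_qfact p (int n + k - 1) = (1 - x) * inv_qfact p (int n + k)"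
    "inv_qfact p (int n - k - 1) = (1 - y) * inv_qfact p (int n - k)"
    using inv_qfact_rec[OF assms, of "int n + k - 1"] inv_qfact_rec[OF assms, of "int n - k - 1"]
    by (simp_all add: x_def y_def)
  have shift: "int n + (k - 1) = int n + k - 1" "int n - (k - 1) = int n - k + 1"
    "int n + (k + 1) = int n + k + 1" "int n - (k + 1) = int n - k - 1" by simp_all
  have c: "central_qbinom p n k = qfact p (2 * n) * ((1 - p * x) * (1 - p * y) * R)"
    by (simp add: central_qbinom_def r R_def)
  have c1: "central_qbinom p n (k - 1) = qfact p (2 * n) * ((1 - x) * (1 - p * x) * R)"
    unfolding central_qbinom_def shift r' r R_def by (simp only: mult_ac)
  have c2: "central_qbinom p n (k + 1) = qfact p (2 * n) * ((1 - y) * (1 - p * y) * R)"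
    unfolding central_qbinom_def shift r' r R_def by (simp only: mult_ac)
  have "qfact p (2 * Suc n) = qfact p (2 * n) * (1 - p * (x * y)) * (1 - p * p * (x * y))"
    by (simp add: qfact_Suc xy[symmetric] algebra_simps)
  moreover have "int (Suc n) + k = int n + k + 1" "int (Suc n) - k = int n - k + 1" by simp_all
  ultimately have c0: "central_qbinom p (Suc n) k =
      qfact p (2 * n) * ((1 - p * (x * y)) * (1 - p * p * (x * y)) * R)"
    unfolding central_qbinom_def R_def by (simp only: mult_ac)
  have e: "p powi (int n + 1 - k) = p * y" "p powi (int n + 1 + k) = p * x"
    using pS[of "int n - k"] pS[of "int n + k"] by (simp_all add: x_def y_def algebra_simps)
  have pp: "p ^ (2 * n + 1) = p * (x * y)" using xy by simp
  show ?thesis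
    unfolding c c0 c1 c2 e pp by (simp add: algebra_simps)
qed

text \<open>In the usual notation $q = e^{-s}$ and $z = e^{-2cs}$.\<close>
lemma finite_triple_product:
  assumes "s > 0"
  shows "((\<lambda>k::int. exp (- s * (of_int k + c)\<^sup>2) * central_qbinom (exp (- 2 * s)) n k) has_sum
           exp (- s * c\<^sup>2) * (\<Prod>i<n. (1 + exp (- s * (2 * real i + 1 + 2 * c))) * (1 + exp (- s * (2 * real i + 1 - 2 * c))))) UNIV"
proof (induction n)
  case 0
  have *: "central_qbinom p 0 k = (if k = 0 then 1 else 0)" for k p
    by (auto simp: central_qbinom_def inv_qfact_def qfact_def)
  show ?case
    by (rule has_sum_finite_neutralI[where B = "{0}"]) (auto simp: *)
next
  case (Suc n)
  define p where "p = exp (- 2 * s)"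
  have p: "0 < p" "p < 1" using assms by (auto simp: p_def)
  define T where "T = (\<lambda>n (k::int). exp (- s * (of_int k + c)\<^sup>2) * central_qbinom p n k)"
  define W where "W = exp (- s * c\<^sup>2) * (\<Prod>i<n. (1 + exp (- s * (2 * real i + 1 + 2 * c))) * (1 + exp (- s * (2 * real i + 1 - 2 * c))))"
  define a b where "a = exp (- s * (2 * real n + 1 + 2 * c))" and "b = exp (- s * (2 * real n + 1 - 2 * c))"
  have pw: "p powi m = exp (- 2 * s * of_int m)" for m
    unfolding p_def by (simp add: exp_power_int mult.commute)
  \<comment> \<open>Completing the square turns the powers of p into shifts of k by one, with the
    two new factors' terms \<open>a\<close> and \<open>b\<close> as coefficients. A shift does not
    change the total \<open>W\<close>, which is therefore multiplied by 1 + ab + a + b.\<close>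
  have "T (Suc n) k = (1 + a * b) * T n k + a * T n (k - 1) + b * T n (k + 1)" for k
  proof -
    have "p ^ (2 * n + 1) = p powi (2 * int n + 1)"
      using power_int_of_nat[of p "2 * n + 1"] by (simp add: add.commute)
    hence "p ^ (2 * n + 1) = a * b"
      by (simp add: pw a_def b_def exp_add[symmetric] algebra_simps)
    moreover have "exp (- s * (of_int k + c)\<^sup>2) * p powi (int n + 1 - k) = a * exp (- s * (of_int (k - 1) + c)\<^sup>2)"
      by (simp add: pw a_def exp_add[symmetric] algebra_simps power2_eq_square)
    moreover have "exp (- s * (of_int k + c)\<^sup>2) * p powi (int n + 1 + k) = b * exp (- s * (of_int (k + 1) + c)\<^sup>2)"
      by (simp add: pw b_def exp_add[symmetric] algebra_simps power2_eq_square)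
    ultimately show ?thesis
      unfolding T_def central_qbinom_Suc[OF p] distrib_left
      by (simp add: mult.assoc[symmetric])
  qed
  hence T: "T (Suc n) = (\<lambda>k. (1 + a * b) * T n k + a * T n (k - 1) + b * T n (k + 1))" by (rule ext)
  have 0: "(T n has_sum W) UNIV"
    using Suc.IH by (simp add: T_def W_def p_def)
  have 1: "((\<lambda>k. T n (k - 1)) has_sum W) UNIV"
    using 0 has_sum_reindex_bij_betw[of "\<lambda>k. k - 1" UNIV UNIV "T n" W]
    by (simp add: bij_betw_def inj_on_def surj_def)
  have 2: "((\<lambda>k. T n (k + 1)) has_sum W) UNIV"
    using 0 has_sum_reindex_bij_betw[of "\<lambda>k. k + 1" UNIV UNIV "T n" W]
    by (simp add: bij_betw_def inj_on_def surj_def)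
  have "(T (Suc n) has_sum ((1 + a * b) * W + a * W + b * W)) UNIV"
    unfolding T by (intro has_sum_add has_sum_cmult_right 0 1 2)
  also have "(1 + a * b) * W + a * W + b * W = W * ((1 + a) * (1 + b))" by algebra
  finally show ?case
    by (simp add: T_def W_def a_def b_def p_def mult.assoc)
qed

text \<open>The partial products decrease, so their limit is also a lower bound. It is nonzero
  because a convergent infinite product vanishes only if some factor does.\<close>

lemma qfact_limit:
  assumes "0 < p" "p < 1"
  obtains P where "P > 0" "qfact p \<longlonglongrightarrow> P" "\<And>n. qfact p n \<ge> P" "\<And>n. qfact p n \<le> 1"
proof -
  have hp: "(\<lambda>k. 1 - p * p ^ k) has_prod qpoch_inf p p"
    using assms by (intro has_prod_qpoch_inf) auto
  have nz: "1 - p * p ^ k \<noteq> 0" for k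
    using assms power_less_one_iff[of p "Suc k"] by simp
  have lim': "qfact p \<longlonglongrightarrow> qpoch_inf p p"
    using has_prod_imp_tendsto'[OF hp] by (simp add: qfact_def[abs_def])
  have "decseq (qfact p)"
    unfolding decseq_Suc_iff qfact_Suc
    using assms qfact_pos[OF assms] by (auto simp: mult_le_cancel_left1)
  hence "qfact p n \<ge> qpoch_inf p p" "qfact p n \<le> qfact p 0" for n
    using lim' by (auto intro: decseq_ge decseqD)
  moreover have "qpoch_inf p p \<noteq> 0"
    using hp has_prod_0_iff nz by metis
  moreover have "qpoch_inf p p \<ge> 0"
    using lim' qfact_pos[OF assms] by (intro LIMSEQ_le_const) (auto intro: less_imp_le)
  ultimately show ?thesis
    using lim' that[of "qpoch_inf p p"] by (auto simp: qfact_def[of _ 0])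
qed


lemma tendsto_central_qbinom:
  assumes "0 < p" "p < 1" and P: "P > 0" "qfact p \<longlonglongrightarrow> P"
  shows "(\<lambda>n. central_qbinom p n k) \<longlonglongrightarrow> 1 / P"
proof -
  have i: "(\<lambda>n. inv_qfact p (int n + l)) \<longlonglongrightarrow> inverse P" for l
  proof -
    have "filterlim (\<lambda>n. nat (int n + l)) at_top sequentially"
      by (rule filterlim_at_top_mono[OF filterlim_minus_const_nat_at_top[of "nat \<bar>l\<bar>"]])
        (intro always_eventually allI, linarith)
    hence "(\<lambda>n. inverse (qfact p (nat (int n + l)))) \<longlonglongrightarrow> inverse P"
      using P by (intro tendsto_inverse filterlim_compose[OF P(2)]) auto
    thus ?thesis
    proof (rule Lim_transform_eventually)
      show "\<forall>\<^sub>F n in sequentially. inverse (qfact p (nat (int n + l))) = inv_qfact p (int n + l)"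
        using eventually_ge_at_top[of "nat \<bar>l\<bar>"] by eventually_elim (auto simp: inv_qfact_def)
    qed
  qed
  have "(\<lambda>n. qfact p (2 * n)) \<longlonglongrightarrow> P"
    by (rule filterlim_compose[OF P(2)]) (auto intro: filterlim_subseq simp: strict_mono_def)
  from tendsto_mult[OF tendsto_mult[OF this i[of k]] i[of "- k"]]
  show ?thesis using P by (simp add: central_qbinom_def field_simps)
qed

text \<open>The bound is uniform in n and k and supplies the majorant for the passage to the limit
  in \<open>triple_product_limit\<close>.\<close>

lemma central_qbinom_bound:
  assumes "0 < p" "p < 1" and P: "P > 0" "\<And>n. qfact p n \<ge> P" "\<And>n. qfact p n \<le> 1"
  shows "0 \<le> central_qbinom p n k" "central_qbinom p n k \<le> inverse P * inverse P"
proof -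
  have i: "0 \<le> inv_qfact p m" "inv_qfact p m \<le> inverse P" for m
    using P qfact_pos[OF assms(1,2), of "nat m"] by (auto simp: inv_qfact_def intro: le_imp_inverse_le)
  have "central_qbinom p n k \<le> 1 * inverse P * inverse P"
    unfolding central_qbinom_def using i P(1) P(3)[of "2 * n"]
    by (intro mult_mono) auto
  thus "central_qbinom p n k \<le> inverse P * inverse P" by simp
  show "0 \<le> central_qbinom p n k"
    unfolding central_qbinom_def using i qfact_pos[OF assms(1,2), of "2 * n"] by simp
qed

text \<open>Jacobi's triple product, obtained by letting n tend to infinity termwise in the finite
  version; Tannery's theorem justifies the exchange, after \<open>int_decode\<close> has turned the
  sum over integers into an ordinary series.\<close>

lemma triple_product_limit:
  assumes "s > 0" and P: "P > 0" "qfact (exp (- 2 * s)) \<longlonglongrightarrow> P"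
    "\<And>n. qfact (exp (- 2 * s)) n \<ge> P" "\<And>n. qfact (exp (- 2 * s)) n \<le> 1"
  shows "(\<lambda>n. exp (- s * c\<^sup>2) * (\<Prod>i<n. (1 + exp (- s * (2 * real i + 1 + 2 * c))) *
             (1 + exp (- s * (2 * real i + 1 - 2 * c))))) \<longlonglongrightarrow> theta c s / P"
proof -
  define p where "p = exp (- 2 * s)"
  have p: "0 < p" "p < 1" using assms by (auto simp: p_def)
  define g where "g = (\<lambda>k::int. exp (- s * (of_int k + c)\<^sup>2))"
  define a where "a = (\<lambda>j n. g (int_decode j) * central_qbinom p n (int_decode j))"
  have to_nat: "(\<lambda>j. f (int_decode j)) sums S" if "(f has_sum S) UNIV" for f :: "int \<Rightarrow> real" and S
    using that has_sum_reindex_bij_betw[OF bij_int_decode, of f S] has_sum_imp_sums by blast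
  have g: "(\<lambda>j. g (int_decode j)) sums theta c s"
    using to_nat[OF has_sum_theta[OF assms(1), of c]] by (simp add: g_def)
  have "(\<lambda>n. \<Sum>j. a j n) \<longlonglongrightarrow> (\<Sum>j. g (int_decode j) * (1 / P))"
  proof (rule tannerys_theorem[THEN conjunct2, THEN conjunct2])
    show "(\<lambda>n. a j n) \<longlonglongrightarrow> g (int_decode j) * (1 / P)" for j
      unfolding a_def by (intro tendsto_mult tendsto_const tendsto_central_qbinom p) (use P in \<open>auto simp: p_def\<close>)
    show "\<forall>\<^sub>F (k, n) in at_top \<times>\<^sub>F sequentially. norm (a k n) \<le> g (int_decode k) * (inverse P * inverse P)"
    proof (intro always_eventually allI, clarify)
      fix k n
      show "norm (a k n) \<le> g (int_decode k) * (inverse P * inverse P)"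
        using central_qbinom_bound[OF p P(1), of n "int_decode k"] P(3,4)
        by (auto simp: a_def abs_mult g_def p_def)
    qed
    show "summable (\<lambda>j. g (int_decode j) * (inverse P * inverse P))"
      using g by (intro summable_mult2) (rule sums_summable)
  qed auto
  moreover have "(\<Sum>j. g (int_decode j) * (1 / P)) = theta c s / P"
    using sums_mult2[OF g, of "1 / P"] by (simp add: sums_iff)
  moreover have "(\<Sum>j. a j n) = exp (- s * c\<^sup>2) * (\<Prod>i<n. (1 + exp (- s * (2 * real i + 1 + 2 * c))) *
             (1 + exp (- s * (2 * real i + 1 - 2 * c))))" for n
    using to_nat[OF finite_triple_product[OF assms(1), of c n]]
    by (simp add: sums_iff a_def g_def p_def)
  ultimately show ?thesis by simp
qed

section \<open>The theta quotient as an infinite product\<close>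

lemma theta0_ge_1:
  assumes "s > 0"
  shows "theta 0 s \<ge> 1"
  using finite_sum_le_has_sum[OF has_sum_theta[OF assms, of 0], of "{0}"] by simp

lemma qpoch_inf_limit:
  assumes "0 < q" "q < 1"
  shows "(\<lambda>n. \<Prod>k<n. 1 + a * q ^ (2 * k)) \<longlonglongrightarrow> qpoch_inf (- a) (q\<^sup>2)"
proof -
  have "\<bar>q\<^sup>2\<bar> < 1" using assms by (simp add: power_less_one_iff)
  from has_prod_imp_tendsto'[OF has_prod_qpoch_inf[OF this, of "- a"]]
  show ?thesis by (simp add: power_mult)
qed

text \<open>The factors interlace: 1 + q^(2k+2) lies between 1 + q^(2k+3) and 1 + q^(2k+1). Hence
  the two products differ at most by the first factor 1 + q. The bounds later separate u(9s) from
  u(s).\<close>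

lemma S1_bounds:
  assumes "0 < q" "q < 1"
  shows "qpoch_inf (- (q\<^sup>2)) (q\<^sup>2) \<ge> 1" "qpoch_inf (- q) (q\<^sup>2) \<ge> 1"
    "ramanujan_selberg_S1 q \<le> q powr (1/8)"
    "q powr (1/8) / (1 + q) \<le> ramanujan_selberg_S1 q"
proof -
  define A where "A = (\<lambda>n. \<Prod>k<n. 1 + q\<^sup>2 * q ^ (2 * k))"
  define B where "B = (\<lambda>n. \<Prod>k<n. 1 + q * q ^ (2 * k))"
  have A: "A \<longlonglongrightarrow> qpoch_inf (- (q\<^sup>2)) (q\<^sup>2)" and B: "B \<longlonglongrightarrow> qpoch_inf (- q) (q\<^sup>2)"
    unfolding A_def B_def by (rule qpoch_inf_limit[OF assms])+
  have A1: "A n \<ge> 1" and B1: "B n \<ge> 1" for n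
    unfolding A_def B_def using assms by (auto intro!: prod_ge_1)
  show a: "qpoch_inf (- (q\<^sup>2)) (q\<^sup>2) \<ge> 1" using A A1 by (intro LIMSEQ_le_const) auto
  show b: "qpoch_inf (- q) (q\<^sup>2) \<ge> 1" using B B1 by (intro LIMSEQ_le_const) auto
  have "A n \<le> B n" for n
    unfolding A_def B_def using assms by (intro prod_mono) (auto simp: power2_eq_square mult_le_cancel_right1)
  hence ab: "qpoch_inf (- (q\<^sup>2)) (q\<^sup>2) \<le> qpoch_inf (- q) (q\<^sup>2)"
    using A B by (intro LIMSEQ_le) auto
  have "B (Suc n) \<le> (1 + q) * A n" for n
  proof -
    have "B (Suc n) = (1 + q) * (\<Prod>k<n. 1 + q * q ^ (2 * Suc k))"
      unfolding B_def by (subst prod.lessThan_Suc_shift) simp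
    also have "\<dots> \<le> (1 + q) * A n"
      unfolding A_def using assms
      by (intro mult_left_mono prod_mono) (auto simp: power2_eq_square mult_le_cancel_right1)
    finally show ?thesis .
  qed
  hence ba: "qpoch_inf (- q) (q\<^sup>2) \<le> (1 + q) * qpoch_inf (- (q\<^sup>2)) (q\<^sup>2)"
    by (intro LIMSEQ_le[OF LIMSEQ_Suc[OF B] tendsto_mult[OF tendsto_const A]]) auto
  show "ramanujan_selberg_S1 q \<le> q powr (1/8)"
    unfolding ramanujan_selberg_S1_def using ab b by (simp add: divide_le_eq mult_left_mono)
  show "q powr (1/8) / (1 + q) \<le> ramanujan_selberg_S1 q"
    unfolding ramanujan_selberg_S1_def using mult_left_mono[OF ba, of "q powr (1/8)"] b assms
    by (simp add: field_simps)
qed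

text \<open>The triple product at c = 0 gives P b^2 and at c = 1/2 gives 2 P q^(1/4) a^2, so the
  common factor P cancels in the quotient.\<close>

lemma theta_ratio_eq_S1:
  assumes "s > 0"
  shows "theta (1/2) s / theta 0 s = 2 * (ramanujan_selberg_S1 (exp (- s)))\<^sup>2"
proof -
  define q where "q = exp (- s)"
  have q: "0 < q" "q < 1" using assms by (auto simp: q_def)
  define A where "A = (\<lambda>n. \<Prod>k<n. 1 + q\<^sup>2 * q ^ (2 * k))"
  define B where "B = (\<lambda>n. \<Prod>k<n. 1 + q * q ^ (2 * k))"
  define a b where "a = qpoch_inf (- (q\<^sup>2)) (q\<^sup>2)" and "b = qpoch_inf (- q) (q\<^sup>2)"
  have A: "A \<longlonglongrightarrow> a" and B: "B \<longlonglongrightarrow> b"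
    unfolding A_def B_def a_def b_def by (rule qpoch_inf_limit[OF q])+
  have ab: "a \<ge> 1" "b \<ge> 1" unfolding a_def b_def by (rule S1_bounds[OF q])+
  have "0 < exp (- 2 * s)" "exp (- 2 * s) < 1" using assms by auto
  then obtain P where P: "P > 0" "qfact (exp (- 2 * s)) \<longlonglongrightarrow> P"
    "\<And>n. qfact (exp (- 2 * s)) n \<ge> P" "\<And>n. qfact (exp (- 2 * s)) n \<le> 1"
    using qfact_limit by blast
  have pq: "q ^ m = exp (- s * real m)" for m
    by (metis exp_of_nat_mult mult.commute q_def)
  have e: "exp (- s * (2 * real k + 1 + 1)) = q\<^sup>2 * q ^ (2 * k)"
    "exp (- s * (2 * real k + 1 - 1)) = q ^ (2 * k)"
    "exp (- s * (2 * real k + 1)) = q * q ^ (2 * k)" for k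
    unfolding pq by (simp_all add: q_def algebra_simps flip: exp_add)
  have "(\<lambda>n. exp (- s * 0\<^sup>2) * (\<Prod>i<n. (1 + exp (- s * (2 * real i + 1 + 2 * 0))) *
             (1 + exp (- s * (2 * real i + 1 - 2 * 0))))) = (\<lambda>n. B n * B n)"
    by (simp only: mult_zero_right add_0_right diff_0_right e prod.distrib B_def) simp
  with triple_product_limit[OF assms P, of 0]
  have "(\<lambda>n. B n * B n) \<longlonglongrightarrow> theta 0 s / P" by simp
  hence t0: "theta 0 s = P * b\<^sup>2"
    using LIMSEQ_unique[OF _ tendsto_mult[OF B B]] P(1) by (simp add: field_simps power2_eq_square)
  \<comment> \<open>For c = 1/2 one of the two products begins with 1 + q^0 = 2 and continues with
    the factors of \<open>A\<close>. This is the source of the factor 2 and of the index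
    shift.\<close>
  have sh: "(\<Prod>k<Suc n. 1 + q ^ (2 * k)) = 2 * A n" for n
    unfolding A_def by (subst prod.lessThan_Suc_shift) (simp add: power2_eq_square mult.assoc)
  have "exp (- s * (1/2)\<^sup>2) * (\<Prod>i<Suc n. (1 + exp (- s * (2 * real i + 1 + 2 * (1/2)))) *
             (1 + exp (- s * (2 * real i + 1 - 2 * (1/2))))) = exp (- s / 4) * (A (Suc n) * (2 * A n))" for n
  proof -
    have "(2::real) * (1/2) = 1" by simp
    thus ?thesis
      by (simp only: e prod.distrib sh) (simp add: A_def power2_eq_square)
  qed
  with LIMSEQ_Suc[OF triple_product_limit[OF assms P, of "1/2"]]
  have "(\<lambda>n. exp (- s / 4) * (A (Suc n) * (2 * A n))) \<longlonglongrightarrow> theta (1/2) s / P" by simp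
  moreover have "(\<lambda>n. exp (- s / 4) * (A (Suc n) * (2 * A n))) \<longlonglongrightarrow> exp (- s / 4) * (a * (2 * a))"
    by (intro tendsto_intros A LIMSEQ_Suc[OF A])
  ultimately have t2: "theta (1/2) s = P * (exp (- s / 4) * (2 * a\<^sup>2))"
    using P(1) LIMSEQ_unique by (fastforce simp: field_simps power2_eq_square)
  have "(q powr (1/8))\<^sup>2 = exp (- s / 4)"
    by (simp add: q_def powr_def power2_eq_square flip: exp_add)
  thus ?thesis
    unfolding t0 t2 ramanujan_selberg_S1_def q_def[symmetric] a_def[symmetric] b_def[symmetric]
    using P(1) ab by (simp add: power_mult_distrib power_divide)
qed


subsection \<open>The arithmetic-geometric mean of theta values\<close>

text \<open>The pair travels in the arguments and only its first entry is returned; the mean M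
  enters as a limit of these values.\<close>

primrec agm :: "nat \<Rightarrow> real \<Rightarrow> real \<Rightarrow> real" where
  "agm 0 a b = a"
| "agm (Suc n) a b = agm n ((a + b) / 2) (sqrt (a * b))"

lemma agm_scale:
  assumes "c \<ge> 0"
  shows "agm n (c * a) (c * b) = c * agm n a b"
proof (induction n arbitrary: a b)
  case (Suc n)
  have "sqrt (c * a * (c * b)) = sqrt (c\<^sup>2 * (a * b))"
    by (simp add: power2_eq_square mult_ac)
  also have "\<dots> = c * sqrt (a * b)"
    using assms by (simp only: real_sqrt_mult real_sqrt_abs abs_of_nonneg)
  finally have "sqrt (c * a * (c * b)) = c * sqrt (a * b)" .
  moreover have "(c * a + c * b) / 2 = c * ((a + b) / 2)" by (simp add: algebra_simps)
  ultimately show ?case using Suc.IH by (simp del: times_divide_eq_right)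
qed simp

lemma agm_mono:
  assumes "0 \<le> a" "a \<le> a'" "0 \<le> b" "b \<le> b'"
  shows "agm n a b \<le> agm n a' b'"
  using assms
proof (induction n arbitrary: a b a' b')
  case (Suc n)
  have "agm n ((a + b) / 2) (sqrt (a * b)) \<le> agm n ((a' + b') / 2) (sqrt (a' * b'))"
    using Suc.prems by (intro Suc.IH) (auto intro: mult_mono)
  thus ?case by simp
qed simp

text \<open>A factor c > 1 independent of n keeps the inequality strict in the limit. One step
  enlarges both means by at least c, and homogeneity and monotonicity carry it through the later
  steps; at step 0 the value is \<open>a\<close> on both sides, hence \<open>Suc n\<close>.\<close>

lemma agm_strict_mono:
  assumes "0 < a" "0 \<le> b" "b < b'"
  obtains c where "c > 1" "\<And>n. c * agm (Suc n) a b \<le> agm (Suc n) a b'"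
proof -
  \<comment> \<open>For b = 0 the geometric mean with \<open>b\<close> vanishes, so any constant
    above 1 serves.\<close>
  define d where "d = (if b = 0 then 2 else sqrt (b' / b))"
  define c where "c = min ((a + b') / (a + b)) d"
  have d: "d > 1" and db: "d * sqrt b \<le> sqrt b'"
    using assms by (auto simp: d_def real_sqrt_divide)
  have c: "c > 1" using assms d by (simp add: c_def)
  have "c * ((a + b) / 2) \<le> (a + b') / (a + b) * ((a + b) / 2)"
    using assms by (intro mult_right_mono) (auto simp: c_def)
  also have "\<dots> = (a + b') / 2" using assms by simp
  finally have 1: "c * ((a + b) / 2) \<le> (a + b') / 2" .
  have "c * sqrt (a * b) \<le> d * sqrt (a * b)"
    using assms by (intro mult_right_mono) (auto simp: c_def)
  also have "\<dots> = sqrt a * (d * sqrt b)" by (simp add: real_sqrt_mult)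
  also have "\<dots> \<le> sqrt a * sqrt b'" using assms db by (intro mult_left_mono) auto
  finally have 2: "c * sqrt (a * b) \<le> sqrt (a * b')" by (simp add: real_sqrt_mult)
  have "c * agm (Suc n) a b \<le> agm (Suc n) a b'" for n
  proof -
    have "c * agm (Suc n) a b = agm n (c * ((a + b) / 2)) (c * sqrt (a * b))"
      using agm_scale[of c n "(a + b) / 2" "sqrt (a * b)"] c by simp
    also have "\<dots> \<le> agm n ((a + b') / 2) (sqrt (a * b'))"
      using 1 2 c assms by (intro agm_mono) auto
    finally show ?thesis by simp
  qed
  with c show ?thesis using that by blast
qed

lemma agm_limit_strict_mono:
  assumes "0 < a" "0 \<le> b" "b < b'" "(\<lambda>n. agm n a b) \<longlonglongrightarrow> X" "(\<lambda>n. agm n a b') \<longlonglongrightarrow> Y" "X > 0"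
  shows "X < Y"
proof -
  obtain c where c: "c > 1" "\<And>n. c * agm (Suc n) a b \<le> agm (Suc n) a b'"
    using agm_strict_mono[OF assms(1-3)] by blast
  have "c * X \<le> Y"
    by (rule LIMSEQ_le[OF tendsto_mult[OF tendsto_const LIMSEQ_Suc[OF assms(4)]] LIMSEQ_Suc[OF assms(5)]])
       (use c(2) in auto)
  moreover have "1 * X < c * X" using c(1) assms(6) by (intro mult_strict_right_mono)
  ultimately show ?thesis by simp
qed

lemma agm_limit_inj:
  assumes "0 < a" "0 \<le> b" "0 \<le> b'" "(\<lambda>n. agm n a b) \<longlonglongrightarrow> X" "(\<lambda>n. agm n a b') \<longlonglongrightarrow> X" "X > 0"
  shows "b = b'"
  using agm_limit_strict_mono[of a b b' X X] agm_limit_strict_mono[of a b' b X X] assms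
  by (cases b b' rule: linorder_cases) auto

text \<open>The alternating series sum (-1)^k q^(k^2), with its even and odd terms already collected
  into two positive series.\<close>

definition theta4 :: "real \<Rightarrow> real" where
  "theta4 s = theta 0 (4 * s) - theta (1/2) (4 * s)"

lemma theta_nonneg: "theta c s \<ge> 0"
  unfolding theta_def by (intro infsum_nonneg) auto

lemma theta4_square:
  assumes "s > 0"
  shows "(theta4 s)\<^sup>2 = (theta 0 (2 * s))\<^sup>2 - (theta (1/2) (2 * s))\<^sup>2"
  using theta3_square[of "2 * s"] theta2_square[of "2 * s"] assms
  by (simp add: theta4_def power2_diff)

lemma theta3_mult_theta4:
  assumes "s > 0"
  shows "theta 0 s * theta4 s = (theta4 (2 * s))\<^sup>2"
proof -
  have "theta 0 s * theta4 s = (theta 0 (4 * s))\<^sup>2 - (theta (1/2) (4 * s))\<^sup>2"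
    unfolding theta_split[OF assms] theta4_def by (simp add: power2_eq_square algebra_simps)
  thus ?thesis using theta4_square[of "2 * s"] assms by simp
qed

text \<open>With x, y the theta_3 and theta_2 values at 2s, the three squares are x^2 + y^2, 2xy and
  x^2 - y^2; the claim is (x^2 + y^2)^2 = (2xy)^2 + (x^2 - y^2)^2.\<close>

lemma theta_quartic:
  assumes "s > 0"
  shows "theta 0 s ^ 4 = theta (1/2) s ^ 4 + theta4 s ^ 4"
proof -
  have "theta 0 s ^ 4 = ((theta 0 s)\<^sup>2)\<^sup>2" "theta (1/2) s ^ 4 = ((theta (1/2) s)\<^sup>2)\<^sup>2"
    "theta4 s ^ 4 = ((theta4 s)\<^sup>2)\<^sup>2" by simp_all
  thus ?thesis
    unfolding theta3_square[OF assms] theta2_square[OF assms] theta4_square[OF assms]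
    by (simp add: power2_eq_square algebra_simps)
qed

lemma agm_theta3_theta4:
  assumes "s > 0"
  shows "agm n ((theta 0 s)\<^sup>2) ((theta4 s)\<^sup>2) = (theta 0 (2 ^ n * s))\<^sup>2"
  using assms
proof (induction n arbitrary: s)
  case (Suc n)
  have "((theta 0 s)\<^sup>2 + (theta4 s)\<^sup>2) / 2 = (theta 0 (2 * s))\<^sup>2"
    using theta3_square[OF Suc.prems] theta4_square[OF Suc.prems] by simp
  moreover have "sqrt ((theta 0 s)\<^sup>2 * (theta4 s)\<^sup>2) = (theta4 (2 * s))\<^sup>2"
    by (simp only: power_mult_distrib[symmetric] theta3_mult_theta4[OF Suc.prems] real_sqrt_abs abs_power2)
  ultimately show ?case using Suc.IH[of "2 * s"] Suc.prems by (simp add: mult_ac)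
qed simp

text \<open>One AGM step yields the two theta squares at s/2, each times 1/2, and homogeneity moves
  this factor outside.\<close>

lemma agm_theta3_theta2:
  assumes "s > 0"
  shows "agm n ((theta 0 s)\<^sup>2) ((theta (1/2) s)\<^sup>2) = (theta 0 (s / 2 ^ n))\<^sup>2 / 2 ^ n"
  using assms
proof (induction n arbitrary: s)
  case (Suc n)
  have s: "s / 2 > 0" using Suc.prems by simp
  have a: "((theta 0 s)\<^sup>2 + (theta (1/2) s)\<^sup>2) / 2 = 1/2 * (theta 0 (s / 2))\<^sup>2"
    using theta3_square[OF s] by simp
  have b: "sqrt ((theta 0 s)\<^sup>2 * (theta (1/2) s)\<^sup>2) = 1/2 * (theta (1/2) (s / 2))\<^sup>2"
    using theta2_square[OF s] theta_nonneg[of 0 s] theta_nonneg[of "1/2" s]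
    by (simp add: real_sqrt_mult mult.commute)
  have "agm (Suc n) ((theta 0 s)\<^sup>2) ((theta (1/2) s)\<^sup>2) =
        1/2 * agm n ((theta 0 (s / 2))\<^sup>2) ((theta (1/2) (s / 2))\<^sup>2)"
    unfolding agm.simps a b by (rule agm_scale) simp
  also have "\<dots> = (theta 0 (s / 2 ^ Suc n))\<^sup>2 / 2 ^ Suc n"
    unfolding Suc.IH[OF s] by (simp add: mult_ac)
  finally show ?case .
qed simp

section \<open>Behaviour of theta_3 at infinity and at zero, and the resulting AGM limits\<close>

lemma theta3_le:
  assumes "s \<ge> 1"
  shows "theta 0 s \<le> 1 + exp (1 - s) * theta 0 1"
proof (rule has_sum_mono)
  show "((\<lambda>k::int. exp (- s * (of_int k + 0)\<^sup>2)) has_sum theta 0 s) UNIV"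
    using assms by (intro has_sum_theta) auto
  have "((\<lambda>k::int. if k = 0 then 1 else 0) has_sum (1::real)) UNIV"
    by (rule has_sum_finite_neutralI[where B = "{0}"]) auto
  thus "((\<lambda>k::int. (if k = 0 then 1 else 0) + exp (1 - s) * exp (- 1 * (of_int k + 0)\<^sup>2))
     has_sum 1 + exp (1 - s) * theta 0 1) UNIV"
    by (intro has_sum_add has_sum_cmult_right has_sum_theta) auto
  fix k :: int
  show "exp (- s * (of_int k + 0)\<^sup>2) \<le>
          (if k = 0 then 1 else 0) + exp (1 - s) * exp (- 1 * (of_int k + 0)\<^sup>2)"
  proof (cases "k = 0")
    case False
    hence "\<bar>k\<bar> \<ge> 1" by linarith
    hence "1 \<le> k\<^sup>2" using one_le_power[of "\<bar>k\<bar>" 2] by simp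
    hence "1 \<le> (real_of_int k)\<^sup>2" using of_int_le_iff[of 1 "k\<^sup>2", where 'a = real] by simp
    \<comment> \<open>Since k^2 >= 1, one has s k^2 >= (s - 1) + k^2, which splits off the decaying
      factor e^(1-s).\<close>
    hence "(s - 1) * 1 \<le> (s - 1) * (real_of_int k)\<^sup>2" using assms by (intro mult_left_mono) auto
    hence "- s * (real_of_int k + 0)\<^sup>2 \<le> (1 - s) + (- 1 * (real_of_int k + 0)\<^sup>2)" by (simp add: algebra_simps)
    hence "exp (- s * (real_of_int k + 0)\<^sup>2) \<le> exp ((1 - s) + (- 1 * (real_of_int k + 0)\<^sup>2))"
      by (simp only: exp_le_cancel_iff)
    also have "\<dots> = exp (1 - s) * exp (- 1 * (real_of_int k + 0)\<^sup>2)" by (rule exp_add)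
    finally show ?thesis using False by simp
  qed simp
qed

lemma tendsto_theta3_at_top: "(theta 0 \<longlongrightarrow> 1) at_top"
proof (rule tendsto_sandwich)
  show "\<forall>\<^sub>F s in at_top. 1 \<le> theta 0 s"
    using eventually_gt_at_top[of 0] by eventually_elim (rule theta0_ge_1)
  show "\<forall>\<^sub>F s in at_top. theta 0 s \<le> 1 + exp (1 - s) * theta 0 1"
    using eventually_ge_at_top[of 1] by eventually_elim (rule theta3_le)
  have "((\<lambda>s::real. exp (1 - s)) \<longlongrightarrow> 0) at_top"
    unfolding exp_diff
    by (intro tendsto_divide_0[OF tendsto_const] filterlim_at_top_imp_at_infinity exp_at_top)
  thus "((\<lambda>s. 1 + exp (1 - s) * theta 0 1) \<longlongrightarrow> 1) at_top"
    using tendsto_add[OF tendsto_const tendsto_mult_left_zero] by fastforce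
qed simp

lemma gauss_integral_limit:
  assumes "s > 0"
  shows "(\<lambda>n. integral {0..real n} (\<lambda>x. exp (- s * x\<^sup>2))) \<longlonglongrightarrow> sqrt (pi / s) / 2"
proof -
  define g where "g = (\<lambda>x::real. indicator {0..} x *\<^sub>R exp (- s * x\<^sup>2))"
  have "has_bochner_integral lborel (\<lambda>x. indicator {0..} (0 + sqrt s * x) *\<^sub>R exp (- (0 + sqrt s * x)\<^sup>2))
          ((sqrt pi / 2) /\<^sub>R \<bar>sqrt s\<bar>)"
    using assms gaussian_moment_0 by (subst lborel_has_bochner_integral_real_affine_iff[symmetric]) auto
  also have "(\<lambda>x. indicator {0..} (0 + sqrt s * x) *\<^sub>R exp (- (0 + sqrt s * x)\<^sup>2)) = g"
    using assms by (auto simp: g_def fun_eq_iff indicator_def power_mult_distrib zero_le_mult_iff)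
  also have "(sqrt pi / 2) /\<^sub>R \<bar>sqrt s\<bar> = sqrt (pi / s) / 2"
    using assms by (simp add: real_sqrt_divide field_simps)
  finally have g: "has_bochner_integral lborel g (sqrt (pi / s) / 2)" .
  have "((\<lambda>y. \<integral> x. indicator {.. y} x *\<^sub>R g x \<partial>lborel) \<longlongrightarrow> sqrt (pi / s) / 2) at_top"
    using tendsto_integral_at_top[of lborel g] has_bochner_integral_integral_eq[OF g] g
    by (metis has_bochner_integral_iff sets_lborel)
  hence "(\<lambda>n. \<integral> x. indicator {.. real n} x *\<^sub>R g x \<partial>lborel) \<longlonglongrightarrow> sqrt (pi / s) / 2"
    by (rule filterlim_compose[OF _ filterlim_real_sequentially])
  moreover have "(\<integral> x. indicator {.. real n} x *\<^sub>R g x \<partial>lborel) = integral {0..real n} (\<lambda>x. exp (- s * x\<^sup>2))" for n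
  proof -
    have "set_integrable lborel {0..real n} (\<lambda>x. exp (- s * x\<^sup>2))"
      by (intro borel_integrable_atLeastAtMost' continuous_intros)
    from set_borel_integral_eq_integral(2)[OF this, symmetric]
    show ?thesis
      by (auto simp: set_lebesgue_integral_def g_def indicator_def intro!: Bochner_Integration.integral_cong)
  qed
  ultimately show ?thesis by simp
qed

text \<open>Let S be the sum over k >= 0, so that theta_3 = 2S - 1. The integral test for the
  decreasing Gaussian puts S minus the half-line integral between 0 and f(0) = 1; doubling and
  subtracting 1 gives the bound. This leading behaviour as s -> 0 replaces the modular
  transformation.\<close>

lemma theta3_near_gauss_integral:
  assumes "s > 0"
  shows "\<bar>theta 0 s - sqrt (pi / s)\<bar> \<le> 1"
proof -
  define f where "f = (\<lambda>x::real. exp (- s * x\<^sup>2))"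
  interpret antimono_fun_sum_integral_diff f
    by unfold_locales (use assms in \<open>auto simp: f_def intro!: power_mono continuous_intros\<close>)
  have "(\<lambda>k::int. f (of_int k)) summable_on UNIV"
    using summable_on_gauss[OF assms, of 0] by (simp add: f_def)
  hence "(\<lambda>k::int. f (of_int k)) summable_on range int" by (rule summable_on_subset) auto
  hence "(\<lambda>n::nat. f (of_nat n)) summable_on UNIV"
    by (subst (asm) summable_on_reindex) (auto simp: o_def inj_on_def)
  then obtain S where S: "((\<lambda>n::nat. f (of_nat n)) has_sum S) UNIV" by (auto simp: summable_on_def)
  hence sums: "(\<lambda>n::nat. f (of_nat n)) sums S" by (rule has_sum_imp_sums)
  hence "(\<lambda>n::nat. f (of_nat (Suc n))) sums (S - 1)" by (subst sums_Suc_iff) (simp add: f_def)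
  hence S': "((\<lambda>n::nat. f (of_nat (Suc n))) has_sum (S - 1)) UNIV"
    by (rule sums_nonneg_imp_has_sum) (simp add: f_def)
  have "((\<lambda>k::int. f (of_int k)) has_sum (S + (S - 1))) UNIV"
  proof (rule has_sum_two_parts[where g = int and h = "\<lambda>n. - int (Suc n)"])
    show "((\<lambda>x. f (real_of_int (- int (Suc x)))) has_sum S - 1) UNIV"
      using S' by (simp add: f_def power2_eq_square algebra_simps)
    show "y \<in> range int \<longleftrightarrow> y \<notin> range (\<lambda>n. - int (Suc n))" for y
      by (cases y rule: int_cases) auto
  qed (use S in \<open>auto simp: inj_on_def\<close>)
  moreover have "((\<lambda>k::int. f (of_int k)) has_sum theta 0 s) UNIV"
    using has_sum_theta[OF assms, of 0] by (simp add: f_def)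
  ultimately have t: "theta 0 s = S + (S - 1)" using has_sum_unique by blast
  have lim: "sum_integral_diff_series \<longlonglongrightarrow> S - sqrt (pi / s) / 2"
    unfolding sum_integral_diff_series_def[abs_def]
    using sums gauss_integral_limit[OF assms] by (intro tendsto_diff) (auto simp: sums_def_le f_def)
  have "S - sqrt (pi / s) / 2 \<ge> 0"
    using lim by (rule LIMSEQ_le_const) (auto intro: sum_integral_diff_series_nonneg)
  moreover have "S - sqrt (pi / s) / 2 \<le> sum_integral_diff_series 0"
    using lim by (rule LIMSEQ_le_const2) (auto intro: sum_integral_diff_series_antimono)
  moreover have "f 0 = 1" by (simp add: f_def)
  hence "sum_integral_diff_series 0 = 1" by (simp add: sum_integral_diff_series_def)
  ultimately show ?thesis unfolding t by (auto simp: abs_le_iff)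
qed

lemma agm_limit_theta3_theta4:
  assumes "s > 0"
  shows "(\<lambda>n. agm n ((theta 0 s)\<^sup>2) ((theta4 s)\<^sup>2)) \<longlonglongrightarrow> 1"
proof -
  have "filterlim (\<lambda>n. 2 ^ n * s) at_top sequentially"
    using assms
    by (intro filterlim_at_top_mult_tendsto_pos[OF tendsto_const]
          filterlim_at_infinity_imp_filterlim_at_top filterlim_realpow_sequentially_gt1) auto
  from tendsto_power[OF filterlim_compose[OF tendsto_theta3_at_top this], of 2]
  show ?thesis by (simp add: agm_theta3_theta4[OF assms])
qed

text \<open>With e = s/2^n the n-th iterate is e theta_3(e)^2 / s, and sqrt(e) theta_3(e) tends to
  sqrt(pi) by the Gaussian comparison.\<close>

lemma agm_limit_theta3_theta2:
  assumes "s > 0"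
  shows "(\<lambda>n. agm n ((theta 0 s)\<^sup>2) ((theta (1/2) s)\<^sup>2)) \<longlonglongrightarrow> pi / s"
proof -
  define e where "e = (\<lambda>n::nat. s / 2 ^ n)"
  have e: "e n > 0" for n using assms by (simp add: e_def)
  have e0: "(\<lambda>n. sqrt (e n)) \<longlonglongrightarrow> 0"
    unfolding e_def using LIMSEQ_divide_realpow_zero[of 2 s] tendsto_real_sqrt by fastforce
  have "\<bar>sqrt (e n) * theta 0 (e n) - sqrt pi\<bar> \<le> sqrt (e n)" for n
  proof -
    have "sqrt (e n) * sqrt (pi / e n) = sqrt pi" using e[of n] by (simp add: real_sqrt_divide)
    hence "sqrt (e n) * theta 0 (e n) - sqrt pi = sqrt (e n) * (theta 0 (e n) - sqrt (pi / e n))"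
      by (simp only: right_diff_distrib)
    hence "\<bar>sqrt (e n) * theta 0 (e n) - sqrt pi\<bar> = sqrt (e n) * \<bar>theta 0 (e n) - sqrt (pi / e n)\<bar>"
      using e[of n] by (simp add: abs_mult)
    also have "\<dots> \<le> sqrt (e n) * 1"
      using e[of n] theta3_near_gauss_integral[OF e, of n] by (intro mult_left_mono) auto
    finally show ?thesis by simp
  qed
  hence "(\<lambda>n. sqrt (e n) * theta 0 (e n) - sqrt pi) \<longlonglongrightarrow> 0"
    by (intro Lim_null_comparison[OF _ e0]) auto
  hence "(\<lambda>n. sqrt (e n) * theta 0 (e n)) \<longlonglongrightarrow> sqrt pi" by (simp add: LIM_zero_iff)
  hence "(\<lambda>n. (sqrt (e n) * theta 0 (e n))\<^sup>2 / s) \<longlonglongrightarrow> (sqrt pi)\<^sup>2 / s"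
    using assms by (intro tendsto_intros) auto
  moreover have "(sqrt (e n) * theta 0 (e n))\<^sup>2 / s = agm n ((theta 0 s)\<^sup>2) ((theta (1/2) s)\<^sup>2)" for n
    using assms e[of n] by (simp add: agm_theta3_theta2[OF assms] power_mult_distrib) (simp add: e_def)
  ultimately show ?thesis by simp
qed


section \<open>The quotient u = theta_2/theta_3 and its modular equation\<close>

definition theta_ratio :: "real \<Rightarrow> real" where
  "theta_ratio s = theta (1/2) s / theta 0 s"

lemma theta2_pos:
  assumes "s > 0"
  shows "theta (1/2) s > 0"
  using finite_sum_le_has_sum[OF has_sum_theta[OF assms, of "1/2"], of "{0}"]
    exp_gt_zero[of "- s * (1/2)\<^sup>2"] by (simp del: exp_gt_zero)

lemma theta3_pos:
  assumes "s > 0"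
  shows "theta 0 s > 0"
  using theta0_ge_1[OF assms] by simp

lemma theta_ratio_pos:
  assumes "s > 0"
  shows "theta_ratio s > 0"
  unfolding theta_ratio_def using assms by (intro divide_pos_pos theta2_pos theta3_pos)

lemma theta4_ratio_fourth_power:
  assumes "s > 0"
  shows "(theta4 s / theta 0 s) ^ 4 = 1 - theta_ratio s ^ 4"
proof -
  have "theta4 s ^ 4 = theta 0 s ^ 4 - theta (1/2) s ^ 4" using theta_quartic[OF assms] by simp
  thus ?thesis
    using theta3_pos[OF assms] by (simp add: theta_ratio_def power_divide diff_divide_distrib)
qed

text \<open>The duplication formula for u: together with \<open>theta4_ratio_fourth_power\<close> it
  determines u(2s) from u(s).\<close>

lemma theta4_ratio_square:
  assumes "s > 0"
  shows "(theta4 s / theta 0 s)\<^sup>2 = (1 - (theta_ratio (2 * s))\<^sup>2) / (1 + (theta_ratio (2 * s))\<^sup>2)"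
proof -
  define a b where "a = (theta 0 (2 * s))\<^sup>2" and "b = (theta (1/2) (2 * s))\<^sup>2"
  have "a > 0" "b > 0" using theta3_pos[of "2 * s"] theta2_pos[of "2 * s"] assms by (simp_all add: a_def b_def)
  hence "1 - b / a = (a - b) / a" "1 + b / a = (a + b) / a"
    by (simp_all add: diff_divide_distrib add_divide_distrib)
  hence "(a - b) / (a + b) = (1 - b / a) / (1 + b / a)" using \<open>a > 0\<close> by simp
  thus ?thesis
    unfolding power_divide theta4_square[OF assms] theta3_square[OF assms] theta_ratio_def a_def b_def .
qed

text \<open>Write theta_3 and theta_4 as A + B and A - B at s, and as C + D and C - D at 3s. Then (A
  + B)(C + D) - (A - B)(C - D) = 2(AD + BC), which \<open>theta2_cubic\<close> identifies with the
  product of the theta_2 values. Dividing by the theta_3 values and taking fourth powers leaves only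
  u.\<close>

lemma theta_ratio_cubic:
  assumes "s > 0"
  shows "(1 - theta_ratio s * theta_ratio (3 * s)) ^ 4 = (1 - theta_ratio s ^ 4) * (1 - theta_ratio (3 * s) ^ 4)"
proof -
  have s: "3 * s > 0" using assms by simp
  have "theta (1/2) s * theta (1/2) (3 * s) = theta 0 s * theta 0 (3 * s) - theta4 s * theta4 (3 * s)"
    unfolding theta2_cubic[OF assms] theta_split[OF assms] theta_split[OF s] theta4_def
    by (simp add: algebra_simps)
  hence "1 - theta_ratio s * theta_ratio (3 * s) = (theta4 s / theta 0 s) * (theta4 (3 * s) / theta 0 (3 * s))"
    using theta3_pos[OF assms] theta3_pos[OF s] by (simp add: theta_ratio_def field_simps)
  thus ?thesis
    by (simp only: power_mult_distrib theta4_ratio_fourth_power[OF assms] theta4_ratio_fourth_power[OF s])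
qed

lemma modular_quartic:
  fixes w x :: real
  assumes "(1 - w * x) ^ 4 = (1 - w ^ 4) * (1 - x ^ 4)"
  shows "x ^ 4 - 4 * w ^ 3 * x ^ 3 + 6 * w\<^sup>2 * x\<^sup>2 - 4 * w * x + w ^ 4 = 0"
  using assms by algebra

text \<open>The modular equation is symmetric in its two moduli, and its instances at s and at 3s
  share u(3s).\<close>

lemma theta_ratio_quartic:
  fixes s :: real
  assumes "s > 0"
  defines "w \<equiv> theta_ratio (3 * s)"
  shows "theta_ratio s ^ 4 - 4 * w ^ 3 * theta_ratio s ^ 3 + 6 * w\<^sup>2 * (theta_ratio s)\<^sup>2 - 4 * w * theta_ratio s + w ^ 4 = 0"
    and "theta_ratio (9 * s) ^ 4 - 4 * w ^ 3 * theta_ratio (9 * s) ^ 3 + 6 * w\<^sup>2 * (theta_ratio (9 * s))\<^sup>2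
           - 4 * w * theta_ratio (9 * s) + w ^ 4 = 0"
proof -
  show "theta_ratio s ^ 4 - 4 * w ^ 3 * theta_ratio s ^ 3 + 6 * w\<^sup>2 * (theta_ratio s)\<^sup>2 - 4 * w * theta_ratio s + w ^ 4 = 0"
    by (rule modular_quartic) (use theta_ratio_cubic[OF assms(1)] in \<open>simp add: w_def mult.commute\<close>)
  have "3 * s > 0" "3 * (3 * s) = 9 * s" using assms by simp_all
  thus "theta_ratio (9 * s) ^ 4 - 4 * w ^ 3 * theta_ratio (9 * s) ^ 3 + 6 * w\<^sup>2 * (theta_ratio (9 * s))\<^sup>2
           - 4 * w * theta_ratio (9 * s) + w ^ 4 = 0"
    by (intro modular_quartic) (use theta_ratio_cubic[of "3 * s"] in \<open>simp add: w_def\<close>)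
qed

lemma S1_pos:
  assumes "0 < q" "q < 1"
  shows "ramanujan_selberg_S1 q > 0"
proof -
  have "0 < q powr (1/8) / (1 + q)" using assms by simp
  with S1_bounds(4)[OF assms] show ?thesis by linarith
qed

text \<open>By \<open>S1_bounds\<close>, S1(q^9) <= q^(1/8) q and q^(1/8)/(1 + q) <= S1(q), so it
  suffices that q(1 + q) < 1. The range s >= 2 gives q <= 1/3 and contains both points 2 pi/3 and 2
  sqrt(2) pi/3.\<close>

lemma theta_ratio_nine_less:
  assumes "s \<ge> 2"
  shows "theta_ratio (9 * s) < theta_ratio s"
proof -
  define q where "q = exp (- s)"
  have "exp s \<ge> 3" using exp_ge_add_one_self[of s] assms by linarith
  hence q: "0 < q" "q \<le> 1/3"
    by (simp_all add: q_def exp_minus field_simps)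
  have q9: "exp (- (9 * s)) = q ^ 9"
    by (simp add: q_def flip: exp_of_nat_mult)
  have q9': "0 < q ^ 9" "q ^ 9 < 1" using q by (auto simp: power_less_one_iff)
  have "q * (1 + q) \<le> 1/3 * (1 + 1/3)" using q by (intro mult_mono) auto
  hence "q powr (1/8) * (q * (1 + q)) < q powr (1/8) * 1" using q by (intro mult_strict_left_mono) auto
  hence "q powr (1/8) * q < q powr (1/8) / (1 + q)" using q by (simp add: field_simps)
  also have "q powr (1/8) * q = (q ^ 9) powr (1/8)"
    using q powr_add[of q "1/8" 1] powr_powr[of q 9 "1/8"] by simp
  also have "q powr (1/8) / (1 + q) \<le> ramanujan_selberg_S1 q" using q by (intro S1_bounds) auto
  finally have "ramanujan_selberg_S1 (q ^ 9) < ramanujan_selberg_S1 q"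
    using S1_bounds(3)[OF q9'] by linarith
  hence "(ramanujan_selberg_S1 (q ^ 9))\<^sup>2 < (ramanujan_selberg_S1 q)\<^sup>2"
    using S1_pos[OF q9'] by (intro power_strict_mono) auto
  thus ?thesis
    using theta_ratio_eq_S1[of s] theta_ratio_eq_S1[of "9 * s"] assms
    unfolding theta_ratio_def by (simp add: q9 q_def)
qed

section \<open>Values of u at 2 pi and 2 sqrt(2) pi\<close>

text \<open>At the self-dual point $s = \pi$ both limits of \<open>agm_limit_theta3_theta2\<close> and
  \<open>agm_limit_theta3_theta4\<close> are equal.\<close>
lemma theta_ratio_pi: "theta_ratio pi ^ 4 = 1/2"
proof -
  have "(theta (1/2) pi)\<^sup>2 = (theta4 pi)\<^sup>2"
    using agm_limit_theta3_theta2[of pi] agm_limit_theta3_theta4[of pi] theta3_pos[of pi]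
    by (intro agm_limit_inj[of "(theta 0 pi)\<^sup>2" _ _ 1]) auto
  hence "((theta (1/2) pi)\<^sup>2)\<^sup>2 = ((theta4 pi)\<^sup>2)\<^sup>2" by (rule arg_cong)
  hence "theta4 pi ^ 4 = theta (1/2) pi ^ 4" by simp
  thus ?thesis
    using theta_quartic[of pi] theta2_pos[of pi] by (simp add: theta_ratio_def power_divide)
qed

lemma theta_ratio_2pi: "theta_ratio (2 * pi) = sqrt 2 - 1"
proof -
  define w where "w = theta_ratio (2 * pi)"
  have w: "w > 0" unfolding w_def by (rule theta_ratio_pos) simp
  define L where "L = (theta4 pi / theta 0 pi)\<^sup>2"
  have "L\<^sup>2 = 1/2"
    using theta4_ratio_fourth_power[of pi] by (simp add: L_def theta_ratio_pi)
  hence "L\<^sup>2 = (sqrt 2 / 2)\<^sup>2" by (simp add: power_divide)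
  moreover have "L \<ge> 0" by (simp add: L_def)
  ultimately have L: "L = sqrt 2 / 2" using power2_eq_iff_nonneg[of L "sqrt 2 / 2"] by simp
  have "sqrt 2 / 2 = (1 - w\<^sup>2) / (1 + w\<^sup>2)"
    using theta4_ratio_square[of pi] L by (simp add: L_def w_def)
  moreover have "1 + w\<^sup>2 > 0" using w by (simp add: add_pos_pos)
  ultimately have "sqrt 2 * (1 + w\<^sup>2) = 2 * (1 - w\<^sup>2)" by (simp add: field_simps)
  hence 1: "w\<^sup>2 * (sqrt 2 + 2) = 2 - sqrt 2" by (simp add: algebra_simps)
  have "(sqrt 2 - 1)\<^sup>2 * (sqrt 2 + 2) = 2 - sqrt 2"
    by (simp add: power2_eq_square algebra_simps)
  with 1 have "w\<^sup>2 * (sqrt 2 + 2) = (sqrt 2 - 1)\<^sup>2 * (sqrt 2 + 2)" by simp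
  hence "w\<^sup>2 = (sqrt 2 - 1)\<^sup>2" by (simp add: add_nonneg_eq_0_iff)
  moreover have "sqrt 2 \<ge> 1" by simp
  ultimately show ?thesis using w by (simp add: w_def[symmetric] power2_eq_iff_nonneg)
qed

text \<open>
  Here the two limits of \<open>theta_ratio_pi\<close> differ by the factor $\sqrt 2$.  The modulus $\sqrt 2 - 1$ is recognized by
  the fact that one step of the AGM from $(1, \sqrt 2 - 1)$ leads to a multiple of $(1, k')$, where
  $k' = \sqrt{2\sqrt 2 - 2}$ is the complementary modulus.
\<close>
lemma theta_ratio_sqrt2_pi: "(theta_ratio (sqrt 2 * pi))\<^sup>2 = sqrt 2 - 1"
proof -
  define s where "s = sqrt 2 * pi"
  have s: "s > 0" by (simp add: s_def)
  define T where "T = 1 / (theta 0 s)\<^sup>2"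
  have T: "T > 0" using theta3_pos[OF s] by (simp add: T_def)
  define k k' k0 k0' where "k = (theta_ratio s)\<^sup>2" and "k' = (theta4 s / theta 0 s)\<^sup>2"
    and "k0 = sqrt 2 - 1" and "k0' = sqrt (2 * sqrt 2 - 2)"
  have norm: "agm n 1 ((x / theta 0 s)\<^sup>2) = T * agm n ((theta 0 s)\<^sup>2) (x\<^sup>2)" for n x
    using agm_scale[of T n "(theta 0 s)\<^sup>2" "x\<^sup>2"] T theta3_pos[OF s]
    by (simp add: T_def power_divide)
  have "(\<lambda>n. agm n 1 k) \<longlonglongrightarrow> T * (pi / s)"
    unfolding k_def theta_ratio_def norm by (intro tendsto_intros agm_limit_theta3_theta2 s)
  hence K: "(\<lambda>n. agm n 1 k) \<longlonglongrightarrow> T / sqrt 2" by (simp add: s_def)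
  have "(\<lambda>n. agm n 1 k') \<longlonglongrightarrow> T * 1"
    unfolding k'_def norm by (intro tendsto_intros agm_limit_theta3_theta4 s)
  hence K': "(\<lambda>n. agm n 1 k') \<longlonglongrightarrow> T" by simp
  have "k'\<^sup>2 = (theta4 s / theta 0 s) ^ 4" "k\<^sup>2 = theta_ratio s ^ 4" by (simp_all add: k_def k'_def)
  hence kk: "k\<^sup>2 + k'\<^sup>2 = 1" using theta4_ratio_fourth_power[OF s] by simp
  have nn: "k \<ge> 0" "k' \<ge> 0" "k0 \<ge> 0" "k0' \<ge> 0" by (simp_all add: k_def k'_def k0_def k0'_def)
  have "k0'\<^sup>2 = 2 * sqrt 2 - 2" by (simp add: k0'_def)
  moreover have "k0\<^sup>2 = 3 - 2 * sqrt 2" by (simp add: k0_def power2_diff)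
  ultimately have kk0: "k0\<^sup>2 + k0'\<^sup>2 = 1" by simp
  have step: "agm (Suc n) 1 k0 = 1 / sqrt 2 * agm n 1 k0'" for n
  proof -
    have 1: "(1 + k0) / 2 = 1 / sqrt 2 * 1" by (simp add: k0_def real_div_sqrt field_simps)
    have "k0 = (2 * sqrt 2 - 2) / 2" by (simp add: k0_def field_simps)
    hence "sqrt k0 = k0' / sqrt 2" unfolding k0'_def by (simp only: real_sqrt_divide)
    hence 2: "sqrt (1 * k0) = 1 / sqrt 2 * k0'" by simp
    show ?thesis unfolding agm.simps 1 2 by (rule agm_scale) simp
  qed
  \<comment> \<open>In terms of limits, M(1,k) = M(1,k')/sqrt 2, and \<open>step\<close> gives the
    same relation between k0 and k0'. Since k' decreases as k grows, k0 < k would enlarge the left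
    side by a factor c and not the right side. The comparison is made at each n before passing to
    the limit.\<close>
  have "\<not> k0 < k"
  proof
    assume "k0 < k"
    then obtain c where c: "c > 1" "\<And>n. c * agm (Suc n) 1 k0 \<le> agm (Suc n) 1 k"
      using agm_strict_mono[of 1 k0 k] nn by auto
    have "k0\<^sup>2 < k\<^sup>2" using \<open>k0 < k\<close> nn by (intro power_strict_mono) auto
    hence "k'\<^sup>2 \<le> k0'\<^sup>2" using kk kk0 by linarith
    hence le: "k' \<le> k0'" using nn power2_le_imp_le by blast
    have "c * (1 / sqrt 2 * agm n 1 k') \<le> agm (Suc n) 1 k" for n
    proof -
      have "agm n 1 k' \<le> agm n 1 k0'" using nn le by (intro agm_mono) auto
      hence "c * (1 / sqrt 2 * agm n 1 k') \<le> c * (1 / sqrt 2 * agm n 1 k0')"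
        using c(1) by (intro mult_left_mono) auto
      also have "\<dots> \<le> agm (Suc n) 1 k" using c(2)[of n] unfolding step .
      finally show ?thesis .
    qed
    hence "c * (1 / sqrt 2 * T) \<le> T / sqrt 2"
      by (intro LIMSEQ_le[OF tendsto_mult[OF tendsto_const tendsto_mult[OF tendsto_const K']] LIMSEQ_Suc[OF K]]) auto
    moreover have "1 * (1 / sqrt 2 * T) < c * (1 / sqrt 2 * T)" using c(1) T by (intro mult_strict_right_mono) auto
    ultimately show False by simp
  qed
  moreover have "\<not> k < k0"
  proof
    assume "k < k0"
    then obtain c where c: "c > 1" "\<And>n. c * agm (Suc n) 1 k \<le> agm (Suc n) 1 k0"
      using agm_strict_mono[of 1 k k0] nn by auto
    have "k\<^sup>2 < k0\<^sup>2" using \<open>k < k0\<close> nn by (intro power_strict_mono) auto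
    hence "k0'\<^sup>2 \<le> k'\<^sup>2" using kk kk0 by linarith
    hence le: "k0' \<le> k'" using nn power2_le_imp_le by blast
    have "c * agm (Suc n) 1 k \<le> 1 / sqrt 2 * agm n 1 k'" for n
    proof -
      have "agm n 1 k0' \<le> agm n 1 k'" using nn le by (intro agm_mono) auto
      hence "1 / sqrt 2 * agm n 1 k0' \<le> 1 / sqrt 2 * agm n 1 k'"
        by (intro mult_left_mono) auto
      with c(2)[of n] show ?thesis unfolding step by linarith
    qed
    hence "c * (T / sqrt 2) \<le> 1 / sqrt 2 * T"
      by (intro LIMSEQ_le[OF tendsto_mult[OF tendsto_const LIMSEQ_Suc[OF K]] tendsto_mult[OF tendsto_const K']]) auto
    moreover have "1 * (T / sqrt 2) < c * (T / sqrt 2)" using c(1) T by (intro mult_strict_right_mono) auto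
    ultimately show False by simp
  qed
  ultimately show ?thesis unfolding k_def k0_def s_def by simp
qed

text \<open>Duplication from sqrt(2) pi: w satisfies L = (1 - w^2)/(1 + w^2) with L^2 = 1 - (sqrt 2
  - 1)^2. The candidate \<open>v\<close>, a root of v^2 + 1 = 2(sqrt 2 + 1)v in (0,1), gives the
  same L, and the expression is injective for positive arguments.\<close>

lemma theta_ratio_2sqrt2_pi: "theta_ratio (2 * sqrt 2 * pi) = sqrt 2 + 1 - sqrt (2 * sqrt 2 + 2)"
proof -
  define s where "s = sqrt 2 * pi"
  have s: "s > 0" by (simp add: s_def)
  define w where "w = theta_ratio (2 * s)"
  have w: "w > 0" unfolding w_def by (rule theta_ratio_pos) (use s in simp)
  define r where "r = sqrt (2 * sqrt 2 + 2)"
  have r2: "r\<^sup>2 = 2 * sqrt 2 + 2" by (simp add: r_def)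
  define L where "L = (theta4 s / theta 0 s)\<^sup>2"
  define v where "v = sqrt 2 + 1 - r"
  have "r\<^sup>2 < (sqrt 2 + 1)\<^sup>2" unfolding r2 by (simp add: power2_sum)
  hence "r < sqrt 2 + 1" by (rule power2_less_imp_less) simp
  hence v: "v > 0" by (simp add: v_def)
  have v2: "v\<^sup>2 = 2 * (sqrt 2 + 1) * v - 1"
    using r2 unfolding v_def by (simp add: power2_eq_square algebra_simps)
  have "L\<^sup>2 = 1 - ((theta_ratio s)\<^sup>2)\<^sup>2"
    using theta4_ratio_fourth_power[OF s] by (simp add: L_def)
  hence L2: "L\<^sup>2 = 2 * sqrt 2 - 2"
    using theta_ratio_sqrt2_pi by (simp add: s_def power2_diff)
  have Lw: "L * (1 + w\<^sup>2) = 1 - w\<^sup>2"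
  proof -
    have "1 + w\<^sup>2 > 0" using w by (simp add: add_pos_pos)
    thus ?thesis using theta4_ratio_square[OF s] by (simp add: L_def w_def field_simps)
  qed
  have Lnn: "L \<ge> 0" by (simp add: L_def)
  have "1 + v\<^sup>2 > 0" by (simp add: add_pos_nonneg)
  define M where "M = (1 - v\<^sup>2) / (1 + v\<^sup>2)"
  have "v < 1"
  proof -
    have "(sqrt 2)\<^sup>2 < r\<^sup>2" unfolding r2 by simp
    hence "sqrt 2 < r" by (rule power2_less_imp_less) (simp add: r_def)
    thus ?thesis by (simp add: v_def)
  qed
  hence "v\<^sup>2 < 1" using v by (simp add: power_less_one_iff)
  hence Mnn: "M \<ge> 0" by (simp add: M_def)
  have Mv: "M * (1 + v\<^sup>2) = 1 - v\<^sup>2"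
    using \<open>1 + v\<^sup>2 > 0\<close> by (simp add: M_def)
  have "(1 - v\<^sup>2)\<^sup>2 = (2 * sqrt 2 - 2) * (1 + v\<^sup>2)\<^sup>2"
  proof -
    have "(1 + v\<^sup>2)\<^sup>2 = (2 * (sqrt 2 + 1) * v)\<^sup>2" using v2 by simp
    hence A: "(1 + v\<^sup>2)\<^sup>2 = 4 * (3 + 2 * sqrt 2) * v\<^sup>2" by (simp add: power_mult_distrib power2_sum)
    have "(1 - v\<^sup>2)\<^sup>2 = (1 + v\<^sup>2)\<^sup>2 - 4 * v\<^sup>2" by (simp add: power2_eq_square algebra_simps)
    thus ?thesis unfolding A by (simp add: algebra_simps)
  qed
  hence "M\<^sup>2 = L\<^sup>2"
    unfolding L2 M_def power_divide using \<open>1 + v\<^sup>2 > 0\<close> by (simp add: field_simps)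
  hence "M = L" using Mnn Lnn by (simp add: power2_eq_iff_nonneg)
  hence "(1 + L) * w\<^sup>2 = (1 + L) * v\<^sup>2" using Lw Mv by (simp add: algebra_simps)
  hence "w\<^sup>2 = v\<^sup>2" using Lnn by simp
  hence "w = v" using w v by (simp add: power2_eq_iff_nonneg)
  thus ?thesis by (simp add: w_def v_def r_def s_def mult.assoc)
qed


subsection \<open>Special values\<close>

text \<open>The quartic with $w = \sqrt 2 - 1$ splits into two quadratic factors over
  $\mathbb{Q}(\sqrt 2, \sqrt 3)$, and the second one has positive coefficients.\<close>
lemma modular_quartic_quadratic_factor_2pi:
  fixes x w :: real
  assumes "x > 0" and "x ^ 4 - 4 * w ^ 3 * x ^ 3 + 6 * w\<^sup>2 * x\<^sup>2 - 4 * w * x + w ^ 4 = 0"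
    and w: "w = sqrt 2 - 1"
  defines "S \<equiv> 2 * w * (sqrt 3 - sqrt 2) * (sqrt 3 + 2)" and "P \<equiv> (w * (sqrt 3 - sqrt 2))\<^sup>2"
  shows "x\<^sup>2 - S * x + P = 0"
proof -
  define t h where "t = sqrt 2" and "h = sqrt 3"
  have t: "t * t = 2" "t\<^sup>2 = 2" and h: "h * h = 3" "h\<^sup>2 = 3" by (simp_all add: t_def h_def)
  \<comment> \<open>The complementary factor: S + S' must be the cubic coefficient 4w^3, and P P' =
    w^4 holds because (sqrt 3 - sqrt 2)(sqrt 3 + sqrt 2) = 1.\<close>
  define S' P' where "S' = 4 * w ^ 3 - S" and "P' = (w * (h + t))\<^sup>2"
  have w2: "w\<^sup>2 = 3 - 2 * t" using w t by (simp add: t_def power2_diff)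
  have w2': "w * w = 3 - 2 * t" using w2 by (simp add: power2_eq_square)
  have w3: "w ^ 3 = w * (3 - 2 * t)" using w2 by (simp add: power3_eq_cube power2_eq_square)
  have c0: "P * P' = w ^ 4"
  proof -
    have "(h - t) * (h + t) = 1" using t h by (simp add: algebra_simps)
    moreover have "P * P' = w ^ 4 * ((h - t) * (h + t))\<^sup>2"
      by (simp add: P_def P'_def t_def h_def) algebra
    ultimately show ?thesis by simp
  qed
  have P: "P = (3 - 2 * t) * (5 - 2 * h * t)" "P' = (3 - 2 * t) * (5 + 2 * h * t)"
    using t h w2 by (simp_all add: P_def P'_def power_mult_distrib power2_diff power2_sum flip: t_def h_def)
  have S: "S = 2 * w * (3 + 2 * h - h * t - 2 * t)"
    using h by (simp add: S_def algebra_simps flip: t_def h_def)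
  have S': "S' = 2 * w * (3 - 2 * t - 2 * h + h * t)"
    unfolding S'_def S w3 by (simp add: algebra_simps)
  have tt: "t * (t * z) = 2 * z" "h * (h * z) = 3 * z" for z
    using t h by (simp_all add: mult.assoc[symmetric])
  have c2: "P + P' + S * S' = 6 * w\<^sup>2"
  proof -
    have "S * S' = 4 * (w * w) * ((3 + 2 * h - h * t - 2 * t) * (3 - 2 * t - 2 * h + h * t))"
      unfolding S S' by algebra
    also have "(3 + 2 * h - h * t - 2 * t) * (3 - 2 * t - 2 * h + h * t) = - 1"
      by (simp add: algebra_simps t h tt)
    finally show ?thesis unfolding P w2' w2 by (simp add: algebra_simps)
  qed
  have c1: "S * P' + S' * P = 4 * w"
  proof -
    have "S * P' + S' * P = 2 * w * ((3 + 2 * h - h * t - 2 * t) * ((3 - 2 * t) * (5 + 2 * h * t)) +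
      (3 - 2 * t - 2 * h + h * t) * ((3 - 2 * t) * (5 - 2 * h * t)))"
      unfolding S S' P by (simp add: algebra_simps)
    also have "(3 + 2 * h - h * t - 2 * t) * ((3 - 2 * t) * (5 + 2 * h * t)) +
      (3 - 2 * t - 2 * h + h * t) * ((3 - 2 * t) * (5 - 2 * h * t)) = 2"
      by (simp add: algebra_simps t h tt)
    finally show ?thesis by simp
  qed
  have "(x\<^sup>2 - S * x + P) * (x\<^sup>2 - S' * x + P') =
    x ^ 4 - (S + S') * x ^ 3 + (P + P' + S * S') * x\<^sup>2 - (S * P' + S' * P) * x + P * P'"
    by algebra
  also have "\<dots> = 0" unfolding c0 c1 c2 using assms(2) by (simp add: S'_def)
  finally have z: "(x\<^sup>2 - S * x + P) * (x\<^sup>2 - S' * x + P') = 0" .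
  have w0: "w > 0" by (simp add: w)
  have "3 - 2 * t - 2 * h + h * t = (2 - t) * (2 - h) - 1" by (simp add: algebra_simps)
  also have "\<dots> < 0"
  proof -
    have "1 < t" "1 < h" "t < 2" "h < 2" by (simp_all add: t_def h_def real_less_lsqrt)
    hence "(2 - t) * (2 - h) < 1 * 1" by (intro mult_strict_mono) auto
    thus ?thesis by simp
  qed
  finally have "S' < 0" unfolding S' using w0 by (simp add: mult_pos_neg)
  hence "- S' * x > 0" using assms(1) by (simp add: mult_neg_pos)
  moreover have "P' \<ge> 0" by (simp add: P'_def)
  ultimately have "x\<^sup>2 - S' * x + P' > 0" using zero_le_power2[of x] by linarith
  with z show ?thesis by simp
qed

text \<open>Here the quadratic factors have constant terms w^4 and 1, and the second is positive for
  x > 0 because its linear coefficient -S' is. The number w enters through its quadratic equation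
  over Q(sqrt 2), so products reduce to a normal form by \<open>tt\<close> and
  \<open>ww\<close>.\<close>

lemma modular_quartic_quadratic_factor_2sqrt2_pi:
  fixes x w :: real
  assumes "x > 0" and "x ^ 4 - 4 * w ^ 3 * x ^ 3 + 6 * w\<^sup>2 * x\<^sup>2 - 4 * w * x + w ^ 4 = 0"
    and w: "w\<^sup>2 = 2 * (sqrt 2 + 1) * w - 1" "0 < w" "w < 1"
  defines "S \<equiv> 2 * w\<^sup>2 * (3 * sqrt 2 + 5)"
  shows "x\<^sup>2 - S * x + w ^ 4 = 0"
proof -
  define t where "t = sqrt 2"
  have t: "t * t = 2" "t > 0" by (simp_all add: t_def)
  have tt: "t * (t * z) = 2 * z" for z using t by (simp add: mult.assoc[symmetric])
  define S' where "S' = 4 * w ^ 3 - S"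
  have w2: "w * w = 2 * (t + 1) * w - 1" using w(1) by (simp add: t_def power2_eq_square)
  have ww: "w * (w * z) = 2 * (t + 1) * (w * z) - z" for z
    using w2 by (simp add: mult.assoc[symmetric]) (simp add: algebra_simps)
  have c2: "w ^ 4 + 1 + S * S' = 6 * w\<^sup>2"
    unfolding S'_def S_def t_def[symmetric]
    by (simp add: power2_eq_square power3_eq_cube power4_eq_xxxx algebra_simps t tt w2 ww)
  have c1: "S + S' * w ^ 4 = 4 * w"
    unfolding S'_def S_def t_def[symmetric]
    by (simp add: power2_eq_square power3_eq_cube power4_eq_xxxx algebra_simps t tt w2 ww)
  have "(x\<^sup>2 - S * x + w ^ 4) * (x\<^sup>2 - S' * x + 1) =
    x ^ 4 - (S + S') * x ^ 3 + (w ^ 4 + 1 + S * S') * x\<^sup>2 - (S + S' * w ^ 4) * x + w ^ 4"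
    by algebra
  also have "\<dots> = 0" unfolding c1 c2 using assms(2) by (simp add: S'_def)
  finally have z: "(x\<^sup>2 - S * x + w ^ 4) * (x\<^sup>2 - S' * x + 1) = 0" .
  have "S' = 2 * w\<^sup>2 * (2 * w - (3 * t + 5))"
    by (simp add: S'_def S_def t_def power2_eq_square power3_eq_cube algebra_simps)
  also have "\<dots> < 0"
  proof (rule mult_pos_neg)
    show "0 < 2 * w\<^sup>2" using w(2) by (intro mult_pos_pos zero_less_power) auto
    show "2 * w - (3 * t + 5) < 0" using w(3) t(2) by linarith
  qed
  finally have "- S' * x > 0" using assms(1) by (simp add: mult_neg_pos)
  hence "x\<^sup>2 - S' * x + 1 > 0" using zero_le_power2[of x] by linarith
  with z show ?thesis by simp
qed

text \<open>The numbers c(a - b)^2 and c(a + b)^2 have sum 2c(a^2 + b^2) and product c^2(a^2 -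
  b^2)^2; the order of x and y assigns them.\<close>

lemma quadratic_ordered_roots:
  fixes x y a b c :: real
  assumes "x\<^sup>2 - 2 * c * (a\<^sup>2 + b\<^sup>2) * x + c\<^sup>2 * (a\<^sup>2 - b\<^sup>2)\<^sup>2 = 0"
    "y\<^sup>2 - 2 * c * (a\<^sup>2 + b\<^sup>2) * y + c\<^sup>2 * (a\<^sup>2 - b\<^sup>2)\<^sup>2 = 0"
    "x < y" "c > 0" "a > 0" "b > 0"
  shows "x = c * (a - b)\<^sup>2" "y = c * (a + b)\<^sup>2"
proof -
  have *: "z = c * (a - b)\<^sup>2 \<or> z = c * (a + b)\<^sup>2"
    if "z\<^sup>2 - 2 * c * (a\<^sup>2 + b\<^sup>2) * z + c\<^sup>2 * (a\<^sup>2 - b\<^sup>2)\<^sup>2 = 0" for z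
  proof -
    have "(z - c * (a - b)\<^sup>2) * (z - c * (a + b)\<^sup>2) = 0" using that by algebra
    thus ?thesis by simp
  qed
  have "0 < 4 * c * (a * b)" using assms by simp
  hence "c * (a - b)\<^sup>2 < c * (a + b)\<^sup>2" by (simp add: power2_eq_square algebra_simps)
  with *[OF assms(1)] *[OF assms(2)] assms(3)
  show "x = c * (a - b)\<^sup>2" "y = c * (a + b)\<^sup>2" by auto
qed

lemma S1_eqI:
  assumes "s > 0" "v \<ge> 0" "theta_ratio s = 2 * v\<^sup>2"
  shows "ramanujan_selberg_S1 (exp (- s)) = v"
proof -
  have "(ramanujan_selberg_S1 (exp (- s)))\<^sup>2 = v\<^sup>2"
    using theta_ratio_eq_S1[OF assms(1)] assms(3) by (simp add: theta_ratio_def)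
  moreover have "ramanujan_selberg_S1 (exp (- s)) > 0" using assms(1) by (intro S1_pos) auto
  ultimately show ?thesis using assms(2) by (simp add: power2_eq_iff_nonneg)
qed

text \<open>The radicals \<open>a\<close>, \<open>b\<close> are chosen with a^2 + b^2 = sqrt 3 + 2
  and a^2 - b^2 = 1, which matches the coefficients S and P of the quadratic factor.\<close>

lemma theta_ratio_6pi:
  defines "a \<equiv> sqrt ((sqrt 3 + 3) / 2)" and "b \<equiv> sqrt ((sqrt 3 + 1) / 2)"
    and "c \<equiv> (sqrt 2 - 1) * (sqrt 3 - sqrt 2)"
  shows "theta_ratio (6 * pi) = c * (a - b)\<^sup>2" "theta_ratio (2 * pi / 3) = c * (a + b)\<^sup>2"
proof -
  have eq: "3 * (2 * pi / 3) = 2 * pi" "9 * (2 * pi / 3) = 6 * pi" by simp_all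
  have ab: "a\<^sup>2 = (sqrt 3 + 3) / 2" "b\<^sup>2 = (sqrt 3 + 1) / 2" "a > 0" "b > 0"
    by (simp_all add: a_def b_def add_pos_pos)
  have sd: "a\<^sup>2 + b\<^sup>2 = sqrt 3 + 2" "a\<^sup>2 - b\<^sup>2 = 1" unfolding ab by (simp_all add: field_simps)
  have c: "c > 0" by (simp add: c_def)
  have quad: "x\<^sup>2 - 2 * c * (a\<^sup>2 + b\<^sup>2) * x + c\<^sup>2 * (a\<^sup>2 - b\<^sup>2)\<^sup>2 = 0"
    if "x > 0" "x ^ 4 - 4 * w ^ 3 * x ^ 3 + 6 * w\<^sup>2 * x\<^sup>2 - 4 * w * x + w ^ 4 = 0" "w = sqrt 2 - 1" for x w
    using modular_quartic_quadratic_factor_2pi[OF that] unfolding that(3) sd c_def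
    by (simp only: mult.assoc power_one mult_1_right)
  have pos: "theta_ratio (6 * pi) > 0" "theta_ratio (2 * pi / 3) > 0" by (simp_all add: theta_ratio_pos)
  note q = theta_ratio_quartic[of "2 * pi / 3", unfolded eq]
  have "theta_ratio (6 * pi) < theta_ratio (2 * pi / 3)"
    using theta_ratio_nine_less[of "2 * pi / 3"] pi_gt3 unfolding eq by simp
  thus "theta_ratio (6 * pi) = c * (a - b)\<^sup>2" "theta_ratio (2 * pi / 3) = c * (a + b)\<^sup>2"
    using quadratic_ordered_roots[OF quad[OF pos(1) q(2) theta_ratio_2pi] quad[OF pos(2) q(1) theta_ratio_2pi] _ c ab(3,4)]
    by simp_all
qed

lemma theta_ratio_6sqrt2_pi:
  defines "a \<equiv> sqrt ((3 * sqrt 2 + 6) / 2)" and "b \<equiv> sqrt ((3 * sqrt 2 + 4) / 2)"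
    and "c \<equiv> (sqrt ((sqrt 2 + 2) / 2) - sqrt (sqrt 2 / 2)) ^ 4"
  shows "theta_ratio (6 * sqrt 2 * pi) = c * (a - b)\<^sup>2" "theta_ratio (2 * sqrt 2 * pi / 3) = c * (a + b)\<^sup>2"
proof -
  define w where "w = theta_ratio (2 * sqrt 2 * pi)"
  define s where "s = 2 * sqrt 2 * pi / 3"
  have eq: "3 * s = 2 * sqrt 2 * pi" "9 * s = 6 * sqrt 2 * pi" by (simp_all add: s_def)
  define r where "r = sqrt (2 * sqrt 2 + 2)"
  have r2: "r\<^sup>2 = 2 * sqrt 2 + 2" by (simp add: r_def)
  have wr: "w = sqrt 2 + 1 - r" unfolding w_def r_def by (rule theta_ratio_2sqrt2_pi)
  have w0: "w > 0" unfolding w_def by (rule theta_ratio_pos) simp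
  have "(sqrt 2)\<^sup>2 < r\<^sup>2" unfolding r2 by simp
  hence "sqrt 2 < r" by (rule power2_less_imp_less) (simp add: r_def)
  hence w1: "w < 1" by (simp add: wr)
  have w2: "w\<^sup>2 = 2 * (sqrt 2 + 1) * w - 1"
    using r2 unfolding wr by (simp add: power2_eq_square algebra_simps)
  \<comment> \<open>This rewrites w as a perfect square: the squares of the two radicals add up to
    sqrt 2 + 1, and twice their product is r.\<close>
  have "sqrt ((sqrt 2 + 2) / 2) * sqrt (sqrt 2 / 2) = r / 2"
  proof -
    have "(sqrt 2 + 2) / 2 * (sqrt 2 / 2) = (2 * sqrt 2 + 2) / 2\<^sup>2"
      by (simp add: algebra_simps)
    thus ?thesis unfolding r_def real_sqrt_mult[symmetric] by (simp only: real_sqrt_divide real_sqrt_abs)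
  qed
  hence "(sqrt ((sqrt 2 + 2) / 2) - sqrt (sqrt 2 / 2))\<^sup>2 = w"
    unfolding power2_diff wr by (simp add: field_simps)
  hence cw: "c = w\<^sup>2" unfolding c_def by (metis power2_eq_square power4_eq_xxxx mult.assoc)
  have c: "c > 0" using w0 by (simp add: cw)
  have ab: "a\<^sup>2 = (3 * sqrt 2 + 6) / 2" "b\<^sup>2 = (3 * sqrt 2 + 4) / 2" "a > 0" "b > 0"
    by (simp_all add: a_def b_def add_pos_pos)
  have sd: "a\<^sup>2 + b\<^sup>2 = 3 * sqrt 2 + 5" "a\<^sup>2 - b\<^sup>2 = 1" unfolding ab by (simp_all add: field_simps)
  have quad: "x\<^sup>2 - 2 * c * (a\<^sup>2 + b\<^sup>2) * x + c\<^sup>2 * (a\<^sup>2 - b\<^sup>2)\<^sup>2 = 0"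
    if "x > 0" "x ^ 4 - 4 * w ^ 3 * x ^ 3 + 6 * w\<^sup>2 * x\<^sup>2 - 4 * w * x + w ^ 4 = 0" for x
    using modular_quartic_quadratic_factor_2sqrt2_pi[OF that w2 w0 w1] unfolding sd cw by simp
  have s: "s > 0" "9 * s > 0" by (simp_all add: s_def)
  note q = theta_ratio_quartic[OF s(1), unfolded eq(1), folded w_def]
  have "1 * 3 \<le> sqrt 2 * pi" using pi_gt3 by (intro mult_mono) auto
  hence "theta_ratio (9 * s) < theta_ratio s"
    by (intro theta_ratio_nine_less) (simp add: s_def mult.commute)
  note roots = quadratic_ordered_roots[OF quad[OF theta_ratio_pos[OF s(2)] q(2)] quad[OF theta_ratio_pos[OF s(1)] q(1)] this c ab(3,4)]
  show "theta_ratio (6 * sqrt 2 * pi) = c * (a - b)\<^sup>2" using roots(1) by (simp only: eq)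
  show "theta_ratio (2 * sqrt 2 * pi / 3) = c * (a + b)\<^sup>2" using roots(2) by (simp only: s_def)
qed

theorem theorem5p3:
  shows "ramanujan_selberg_S1 (exp (- (6 * pi))) =
           1 / sqrt 2 * sqrt (sqrt 2 - 1) * sqrt (sqrt 3 - sqrt 2) *
           (sqrt ((sqrt 3 + 3) / 2) - sqrt ((sqrt 3 + 1) / 2)) \<and>
         ramanujan_selberg_S1 (exp (- (2 * pi / 3))) =
           1 / sqrt 2 * sqrt (sqrt 2 - 1) * sqrt (sqrt 3 - sqrt 2) *
           (sqrt ((sqrt 3 + 3) / 2) + sqrt ((sqrt 3 + 1) / 2)) \<and>
         ramanujan_selberg_S1 (exp (- (6 * sqrt 2 * pi))) =
           1 / sqrt 2 * (sqrt ((sqrt 2 + 2) / 2) - sqrt (sqrt 2 / 2))\<^sup>2 *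
           (sqrt ((3 * sqrt 2 + 6) / 2) - sqrt ((3 * sqrt 2 + 4) / 2)) \<and>
         ramanujan_selberg_S1 (exp (- (2 * sqrt 2 * pi / 3))) =
           1 / sqrt 2 * (sqrt ((sqrt 2 + 2) / 2) - sqrt (sqrt 2 / 2))\<^sup>2 *
           (sqrt ((3 * sqrt 2 + 6) / 2) + sqrt ((3 * sqrt 2 + 4) / 2))"
proof (intro conjI)
  \<comment> \<open>The right-hand sides are brought to the form 2v^2 that \<open>S1_eqI\<close>
    compares with u; the 2 cancels the square of 1/sqrt 2.\<close>
  have 1: "2 * (1 / sqrt 2 * sqrt (sqrt 2 - 1) * sqrt (sqrt 3 - sqrt 2) * z)\<^sup>2 =
      (sqrt 2 - 1) * (sqrt 3 - sqrt 2) * z\<^sup>2" for z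
    by (simp add: power_mult_distrib power_divide)
  have 2: "2 * (1 / sqrt 2 * y\<^sup>2 * z)\<^sup>2 = y ^ 4 * z\<^sup>2" for y z :: real
    by (simp add: power_mult_distrib power_divide)
  show "ramanujan_selberg_S1 (exp (- (6 * pi))) =
           1 / sqrt 2 * sqrt (sqrt 2 - 1) * sqrt (sqrt 3 - sqrt 2) *
           (sqrt ((sqrt 3 + 3) / 2) - sqrt ((sqrt 3 + 1) / 2))"
    by (rule S1_eqI) (unfold 1 theta_ratio_6pi, simp_all)
  show "ramanujan_selberg_S1 (exp (- (2 * pi / 3))) =
           1 / sqrt 2 * sqrt (sqrt 2 - 1) * sqrt (sqrt 3 - sqrt 2) *
           (sqrt ((sqrt 3 + 3) / 2) + sqrt ((sqrt 3 + 1) / 2))"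
    by (rule S1_eqI) (unfold 1 theta_ratio_6pi, simp_all)
  show "ramanujan_selberg_S1 (exp (- (6 * sqrt 2 * pi))) =
           1 / sqrt 2 * (sqrt ((sqrt 2 + 2) / 2) - sqrt (sqrt 2 / 2))\<^sup>2 *
           (sqrt ((3 * sqrt 2 + 6) / 2) - sqrt ((3 * sqrt 2 + 4) / 2))"
    by (rule S1_eqI) (unfold 2 theta_ratio_6sqrt2_pi, simp_all)
  show "ramanujan_selberg_S1 (exp (- (2 * sqrt 2 * pi / 3))) =
           1 / sqrt 2 * (sqrt ((sqrt 2 + 2) / 2) - sqrt (sqrt 2 / 2))\<^sup>2 *
           (sqrt ((3 * sqrt 2 + 6) / 2) + sqrt ((3 * sqrt 2 + 4) / 2))"
    by (rule S1_eqI) (unfold 2 theta_ratio_6sqrt2_pi, simp_all)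
qed

end
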